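(* Let $\mathbb{K}$ be a field containing $\mathbb{Q}$ and let $n\in\{1,2,3,\dots\}\cup\{\infty\}$. Let $\mathcal{N}$ be the algebra of symmetric polynomials in the $n$ noncommuting variables $\mathbf{x}$ (defined in the context), graded by degree, and let $\Lambda\subseteq\mathcal{N}$ be the subspace of place-action invariants, i.e. $\Lambda=\mathrm{span}\{\mathbf{m}_\mu\}$. Then there is a graded subspace $\mathcal{C}$ of $\mathcal{N}$ together with an isomorphism of graded vector spaces $\mathcal{N}\simeq\mathcal{C}\otimes\Lambda$.
   Context: Let $\mathbf{x}=\{x_1,\dots,x_n\}$ be noncommuting variables (countably many if $n=\infty$), and $T=\mathbb{K}\langle\mathbf{x}\rangle$ (for $n=\infty$, formal series of bounded degree). A degree-$d$ monomial $\mathbf{z}=z_1\cdots z_d$ is a function $[d]\to\mathbf{x}$; its type $\tau(\mathbf{z})$ is the set partition of $[d]=\{1,\dots,d\}$ formed by the nonempty fibers of $\mathbf{z}$. For a set partition $\mathbf{A}$ of $[d]$ put $m_{\mathbf{A}}=\sum_{\tau(\mathbf{z})=\mathbf{A}}\mathbf{z}$ (so $m_{\mathbf{A}}=0$ if $\mathbf{A}$ has more than $n$ parts; $m_{\emptyset}=1$). $\mathcal{N}$ is the span of all $m_{\mathbf{A}}$; equivalently the invariants of $T$ under permuting the variables. The shape $\lambda(\mathbf{A})$ of a set partition is the integer partition formed by its block sizes; $\mathcal{N}_\mu=\mathrm{span}\{m_{\mathbf{A}}:\lambda(\mathbf{A})=\mu\}$. The symmetric group $\mathfrak{S}_d$ acts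 on $\mathcal{N}_d$ (the degree-$d$ part) on the right by the place-action $m_{\mathbf{A}}\cdot\rho=m_{\rho^{-1}\cdot\mathbf{A}}$, where $\rho^{-1}\cdot\{A_1,\dots,A_r\}=\{\rho^{-1}(A_1),\dots,\rho^{-1}(A_r)\}$ (induced from $\mathbf{z}\mapsto\mathbf{z}\circ\rho$). For a partition $\mu=1^{a_1}2^{a_2}\cdots$ of $d$ put $\mu^{!}=a_1!a_2!\cdots$ and $\mathbf{m}_\mu=\frac{1}{(\dim\mathcal{N}_\mu)\,\mu^{!}}\sum_{\lambda(\mathbf{A})=\mu}m_{\mathbf{A}}$ (taken to be $0$ when $\mathcal{N}_\mu=0$). $\Lambda$ is the span of all $\mathbf{m}_\mu$, which is the space of invariants of the place-action. *)

theory Defs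
  imports
    Complex_Main
    "HOL-Library.Function_Algebras"
    "HOL-Library.Disjoint_Sets"
    "HOL-Library.Multiset"
    "HOL-Library.Extended_Nat"
begin

section \<open>Vector spaces of scalar-valued functions\<close>

definition fscale :: "'k::field \<Rightarrow> ('w \<Rightarrow> 'k) \<Rightarrow> ('w \<Rightarrow> 'k)" where
  "fscale c f = (\<lambda>w. c * f w)"

interpretation fs: vector_space "fscale :: 'k::field \<Rightarrow> ('w \<Rightarrow> 'k) \<Rightarrow> ('w \<Rightarrow> 'k)"
  by unfold_locales (auto simp: fscale_def fun_eq_iff algebra_simps)

definition linear_iso_betw ::
  "(('v \<Rightarrow> 'k::field) \<Rightarrow> ('w \<Rightarrow> 'k)) \<Rightarrow> ('v \<Rightarrow> 'k) set \<Rightarrow> ('w \<Rightarrow> 'k) set \<Rightarrow> bool" where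
  "linear_iso_betw \<phi> V W \<longleftrightarrow>
     (\<forall>f\<in>V. \<forall>g\<in>V. \<phi> (f + g) = \<phi> f + \<phi> g) \<and>
     (\<forall>c. \<forall>f\<in>V. \<phi> (fscale c f) = fscale c (\<phi> f)) \<and>
     bij_betw \<phi> V W"


section \<open>Noncommutative series, graded by degree\<close>

text \<open>
  The variables are indexed by the naturals \<open>i\<close> with \<open>enat i < n\<close>. A monomial
  \<open>z\<^sub>1 \<cdots> z\<^sub>d\<close> is the list of the indices of its letters, and a series is its
  coefficient function on lists. Bounding the degree gives the free algebra when \<open>n\<close> is finite
  and the formal series of bounded degree when \<open>n = \<infinity>\<close>.
\<close>

definition monomials :: "enat \<Rightarrow> nat list set" where
  "monomials n = {w. \<forall>x\<in>set w. enat x < n}"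

definition nc_series :: "enat \<Rightarrow> (nat list \<Rightarrow> 'k::field) set" where
  "nc_series n = {f. (\<forall>w. f w \<noteq> 0 \<longrightarrow> w \<in> monomials n) \<and> (\<exists>D. \<forall>w. f w \<noteq> 0 \<longrightarrow> length w \<le> D)}"

definition homogeneous_component :: "nat \<Rightarrow> (nat list \<Rightarrow> 'k::field) \<Rightarrow> (nat list \<Rightarrow> 'k)" where
  "homogeneous_component d f = (\<lambda>w. if length w = d then f w else 0)"

definition degree_part :: "nat \<Rightarrow> (nat list \<Rightarrow> 'k::field) set \<Rightarrow> (nat list \<Rightarrow> 'k) set" where
  "degree_part d V = {f \<in> V. \<forall>w. f w \<noteq> 0 \<longrightarrow> length w = d}"

definition graded_subspace :: "(nat list \<Rightarrow> 'k::field) set \<Rightarrow> (nat list \<Rightarrow> 'k) set \<Rightarrow> bool" where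
  "graded_subspace C V \<longleftrightarrow>
     fs.subspace C \<and> C \<subseteq> V \<and> (\<forall>f\<in>C. \<forall>d. homogeneous_component d f \<in> C)"


section \<open>Symmetric functions in noncommuting variables\<close>

text \<open>Positions in a monomial are numbered from 1.\<close>

definition word_type :: "nat list \<Rightarrow> nat set set" where
  "word_type w = {{i \<in> {1..length w}. w ! (i - 1) = x} | x. x \<in> set w}"

definition m_fun :: "enat \<Rightarrow> nat set set \<Rightarrow> (nat list \<Rightarrow> 'k::field)" where
  "m_fun n A = (\<lambda>w. if w \<in> monomials n \<and> word_type w = A then 1 else 0)"

definition NCSym :: "enat \<Rightarrow> (nat list \<Rightarrow> 'k::field) set" where
  "NCSym n = fs.span {m_fun n A | A d. partition_on {1..d} A}"

definition shape :: "nat set set \<Rightarrow> nat multiset" where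
  "shape A = image_mset card (mset_set A)"

definition set_partitions_of_shape :: "nat multiset \<Rightarrow> nat set set set" where
  "set_partitions_of_shape \<mu> = {A. partition_on {1..sum_mset \<mu>} A \<and> shape A = \<mu>}"

definition NCSym_shape :: "enat \<Rightarrow> nat multiset \<Rightarrow> (nat list \<Rightarrow> 'k::field) set" where
  "NCSym_shape n \<mu> = fs.span (m_fun n ` set_partitions_of_shape \<mu>)"

definition mult_fact :: "nat multiset \<Rightarrow> nat" where
  "mult_fact \<mu> = (\<Prod>i\<in>set_mset \<mu>. fact (count \<mu> i))"

text \<open>
  If \<open>NCSym_shape n \<mu>\<close> is the zero space, then the coefficient below is \<open>1 / 0 = 0\<close>
  and \<open>bold_m n \<mu> = 0\<close>.
\<close>

definition bold_m :: "enat \<Rightarrow> nat multiset \<Rightarrow> (nat list \<Rightarrow> 'k::field)" where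
  "bold_m n \<mu> =
     fscale (1 / (of_nat (fs.dim (NCSym_shape n \<mu> :: (nat list \<Rightarrow> 'k) set)) * of_nat (mult_fact \<mu>)))
       (\<Sum>A\<in>set_partitions_of_shape \<mu>. m_fun n A)"

definition Lambda :: "enat \<Rightarrow> (nat list \<Rightarrow> 'k::field) set" where
  "Lambda n = fs.span {bold_m n \<mu> | \<mu>. 0 \<notin># \<mu>}"

lemma finite_set_partitions_of_shape: "finite (set_partitions_of_shape \<mu>)"
  by (rule finite_subset[of _ "Pow (Pow {1..sum_mset \<mu>})"])
     (auto simp: set_partitions_of_shape_def partition_on_def)

lemma word_type_partition_on: "partition_on {1..length w} (word_type w)"
proof (rule partition_onI)
  show "\<Union> (word_type w) = {1..length w}"
  proof
    show "{1..length w} \<subseteq> \<Union> (word_type w)"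
    proof
      fix i assume i: "i \<in> {1..length w}"
      then have "w ! (i - 1) \<in> set w" by auto
      with i show "i \<in> \<Union> (word_type w)"
        unfolding word_type_def by blast
    qed
  qed (auto simp: word_type_def)
next
  have "p \<noteq> {}" if "p \<in> word_type w" for p
  proof -
    from that obtain x where x: "x \<in> set w" "p = {i \<in> {1..length w}. w ! (i - 1) = x}"
      unfolding word_type_def by blast
    then obtain j where "j < length w" "w ! j = x" by (auto simp: in_set_conv_nth)
    then have "Suc j \<in> p" using x by auto
    then show ?thesis by blast
  qed
  then show "{} \<notin> word_type w" by blast
qed (auto simp: word_type_def disjnt_def)

lemma m_fun_empty: "m_fun n {} = (\<lambda>w. if w = [] then 1 else 0)"
proof -
  have "word_type w = {} \<longleftrightarrow> w = []" for w
    by (cases w) (auto simp: word_type_def)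
  then show ?thesis by (auto simp: m_fun_def monomials_def fun_eq_iff)
qed

lemma m_fun_nc_series:
  assumes "partition_on {1..d} A"
  shows "m_fun n A \<in> (nc_series n :: (nat list \<Rightarrow> 'k::field) set)"
proof -
  have "length w = d" if "word_type w = A" for w
  proof -
    have "{1..length w} = {1..d}"
      using word_type_partition_on[of w] assms that by (simp add: partition_on_def)
    then show ?thesis by (metis card_atLeastAtMost diff_Suc_1)
  qed
  then show ?thesis by (auto simp: nc_series_def m_fun_def)
qed

lemma subspace_nc_series: "fs.subspace (nc_series n :: (nat list \<Rightarrow> 'k::field) set)"
proof (rule fs.subspaceI)
  fix f g :: "nat list \<Rightarrow> 'k" assume "f \<in> nc_series n" "g \<in> nc_series n"
  then obtain D E where *: "\<forall>w. f w \<noteq> 0 \<longrightarrow> w \<in> monomials n \<and> length w \<le> D"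
    "\<forall>w. g w \<noteq> 0 \<longrightarrow> w \<in> monomials n \<and> length w \<le> E"
    unfolding nc_series_def by blast
  have "w \<in> monomials n \<and> length w \<le> max D E" if "f w + g w \<noteq> 0" for w
  proof (cases "f w = 0")
    case True
    with that *(2) show ?thesis by (auto simp: le_max_iff_disj)
  next
    case False
    with *(1) show ?thesis by (auto simp: le_max_iff_disj)
  qed
  then show "f + g \<in> nc_series n" unfolding nc_series_def by auto
qed (auto simp: nc_series_def fscale_def)

lemma NCSym_subset_nc_series: "NCSym n \<subseteq> (nc_series n :: (nat list \<Rightarrow> 'k::field) set)"
  unfolding NCSym_def
  by (rule fs.span_minimal) (auto intro: m_fun_nc_series subspace_nc_series)

lemma Lambda_subset_NCSym: "Lambda n \<subseteq> (NCSym n :: (nat list \<Rightarrow> 'k::field) set)"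
  unfolding Lambda_def
proof (rule fs.span_minimal)
  show "fs.subspace (NCSym n :: (nat list \<Rightarrow> 'k) set)"
    unfolding NCSym_def by (rule fs.subspace_span)
  have "bold_m n \<mu> \<in> (NCSym n :: (nat list \<Rightarrow> 'k) set)" for \<mu>
    unfolding bold_m_def NCSym_def
    by (intro fs.span_scale fs.span_sum fs.span_base) (auto simp: set_partitions_of_shape_def)
  then show "{bold_m n \<mu> | \<mu>. 0 \<notin># \<mu>} \<subseteq> (NCSym n :: (nat list \<Rightarrow> 'k) set)" by blast
qed


section \<open>Tensor products\<close>

text \<open>
  The tensor product of two spaces of scalar-valued functions is realised inside the functions
  of two arguments, with \<open>(f \<otimes> g) (u, v) = f u * g v\<close>. The lemmas
  \<open>tensor_space_universal\<close> and \<open>tensor_space_unique\<close> show that this model has the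
  universal property of the tensor product.
\<close>

definition pure_tensor ::
  "('v \<Rightarrow> 'k::field) \<Rightarrow> ('w \<Rightarrow> 'k) \<Rightarrow> ('v \<times> 'w \<Rightarrow> 'k)" where
  "pure_tensor f g = (\<lambda>(u, v). f u * g v)"

definition tensor_space ::
  "('v \<Rightarrow> 'k::field) set \<Rightarrow> ('w \<Rightarrow> 'k) set \<Rightarrow> ('v \<times> 'w \<Rightarrow> 'k) set" where
  "tensor_space V W = fs.span {pure_tensor f g | f g. f \<in> V \<and> g \<in> W}"

definition tensor_degree_part ::
  "nat \<Rightarrow> (nat list \<Rightarrow> 'k::field) set \<Rightarrow> (nat list \<Rightarrow> 'k) set
    \<Rightarrow> (nat list \<times> nat list \<Rightarrow> 'k) set" where
  "tensor_degree_part d V W =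
     fs.span {pure_tensor f g | f g i j. i + j = d \<and> f \<in> degree_part i V \<and> g \<in> degree_part j W}"

lemma pure_tensor_sum_eq_0:
  fixes a :: "('v \<Rightarrow> 'k::field) \<times> ('w \<Rightarrow> 'k) \<Rightarrow> 'k"
  assumes B: "fs.independent B" and D: "fs.independent D"
    and F: "finite F" "F \<subseteq> B" and G: "finite G" "G \<subseteq> D"
    and 0: "(\<Sum>b\<in>F. \<Sum>d\<in>G. fscale (a (b, d)) (pure_tensor b d)) = 0"
    and bd: "b \<in> F" "d \<in> G"
  shows "a (b, d) = 0"
proof -
  have sum_app: "(\<Sum>x\<in>X. h x) y = (\<Sum>x\<in>X. h x y)"
    for X :: "'x set" and h :: "'x \<Rightarrow> 'y \<Rightarrow> 'k" and y
    by (induction X rule: infinite_finite_induct) auto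
  have *: "(\<Sum>b\<in>F. a (b, d) * b u) = 0" if "d \<in> G" for u d
  proof -
    have "(\<Sum>d\<in>G. fscale (\<Sum>b\<in>F. a (b, d) * b u) d) = 0"
    proof
      fix v
      have "(\<Sum>d\<in>G. fscale (\<Sum>b\<in>F. a (b, d) * b u) d) v
          = (\<Sum>d\<in>G. \<Sum>b\<in>F. a (b, d) * (b u * d v))"
        by (simp add: sum_app fscale_def sum_distrib_right mult.assoc)
      also have "\<dots> = (\<Sum>b\<in>F. \<Sum>d\<in>G. a (b, d) * (b u * d v))"
        by (rule sum.swap)
      also have "\<dots> = (\<Sum>b\<in>F. \<Sum>d\<in>G. fscale (a (b, d)) (pure_tensor b d)) (u, v)"
        by (simp add: sum_app fscale_def pure_tensor_def)
      finally show "(\<Sum>d\<in>G. fscale (\<Sum>b\<in>F. a (b, d) * b u) d) v = 0 v"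
        by (simp add: 0)
    qed
    then show ?thesis
      by (rule fs.independentD[OF D G]) (rule that)
  qed
  have "(\<Sum>b\<in>F. fscale (a (b, d)) b) = 0"
    by (rule ext) (simp add: sum_app fscale_def * bd)
  then show ?thesis by (rule fs.independentD[OF B F]) (rule bd)
qed

lemma pure_tensor_basis:
  fixes B :: "('v \<Rightarrow> 'k::field) set" and D :: "('w \<Rightarrow> 'k) set"
  assumes B: "fs.independent B" and D: "fs.independent D"
  shows "inj_on (\<lambda>(b, d). pure_tensor b d) (B \<times> D)"
    and "fs.independent ((\<lambda>(b, d). pure_tensor b d) ` (B \<times> D))"
proof -
  let ?t = "\<lambda>(b, d). pure_tensor b d :: 'v \<times> 'w \<Rightarrow> 'k"
  have key: "a p = 0"
    if S: "finite S" "S \<subseteq> B \<times> D" and 0: "(\<Sum>p\<in>S. fscale (a p) (?t p)) = 0" and p: "p \<in> S"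
    for a S p
  proof -
    let ?a = "\<lambda>p. if p \<in> S then a p else 0"
    have "(\<Sum>b\<in>fst ` S. \<Sum>d\<in>snd ` S. fscale (?a (b, d)) (pure_tensor b d))
        = (\<Sum>p\<in>fst ` S \<times> snd ` S. fscale (?a p) (?t p))"
      by (simp only: sum.cartesian_product) (auto intro!: sum.cong)
    also have "\<dots> = (\<Sum>p\<in>S. fscale (a p) (?t p))"
      using S by (intro sum.mono_neutral_cong_right) (auto simp: fscale_def fun_eq_iff image_iff, force+)
    finally have 1: "(\<Sum>b\<in>fst ` S. \<Sum>d\<in>snd ` S. fscale (?a (b, d)) (pure_tensor b d)) = 0"
      using 0 by simp
    have "?a (fst p, snd p) = 0"
      by (rule pure_tensor_sum_eq_0[OF B D _ _ _ _ 1]) (use S p in auto)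
    then show ?thesis using p by simp
  qed
  show inj: "inj_on ?t (B \<times> D)"
  proof (rule inj_onI, rule ccontr)
    fix p q assume pq: "p \<in> B \<times> D" "q \<in> B \<times> D" "?t p = ?t q" "p \<noteq> q"
    let ?a = "\<lambda>r. if r = p then 1 else -1 :: 'k"
    have "(\<Sum>r\<in>{p, q}. fscale (?a r) (?t r)) = 0"
      using pq by (auto simp: fscale_def fun_eq_iff)
    from key[OF _ _ this, of p] pq show False by auto
  qed
  show "fs.independent (?t ` (B \<times> D))"
    unfolding fs.independent_explicit_finite_subsets
  proof (intro allI impI ballI)
    fix S u x
    assume S: "S \<subseteq> ?t ` (B \<times> D)" "finite S" and 0: "(\<Sum>v\<in>S. fscale (u v) v) = 0" and x: "x \<in> S"
    from S obtain R where R: "R \<subseteq> B \<times> D" "finite R" "S = ?t ` R"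
      by (meson finite_subset_image)
    have "inj_on ?t R" using inj R(1) by (rule inj_on_subset)
    then have "(\<Sum>p\<in>R. fscale ((u \<circ> ?t) p) (?t p)) = 0"
      using 0 by (simp add: R(3) sum.reindex comp_def)
    from key[OF R(2,1) this] x R(3) show "u x = 0" by auto
  qed
qed

lemma pure_tensor_bilinear:
  "pure_tensor (f + f') g = pure_tensor f g + pure_tensor f' g"
  "pure_tensor f (g + g') = pure_tensor f g + pure_tensor f g'"
  "pure_tensor (fscale c f) g = fscale c (pure_tensor f g)"
  "pure_tensor f (fscale c g) = fscale c (pure_tensor f g)"
  by (auto simp: pure_tensor_def fscale_def fun_eq_iff algebra_simps)

lemma tensor_space_universal:
  fixes V :: "('v \<Rightarrow> 'k::field) set" and W :: "('w \<Rightarrow> 'k) set"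
    and scale :: "'k \<Rightarrow> 'x::ab_group_add \<Rightarrow> 'x"
    and \<beta> :: "('v \<Rightarrow> 'k) \<Rightarrow> ('w \<Rightarrow> 'k) \<Rightarrow> 'x"
  assumes "vector_space scale" and V: "fs.subspace V" and W: "fs.subspace W"
    and add1: "\<And>f f' g. f \<in> V \<Longrightarrow> f' \<in> V \<Longrightarrow> g \<in> W \<Longrightarrow> \<beta> (f + f') g = \<beta> f g + \<beta> f' g"
    and add2: "\<And>f g g'. f \<in> V \<Longrightarrow> g \<in> W \<Longrightarrow> g' \<in> W \<Longrightarrow> \<beta> f (g + g') = \<beta> f g + \<beta> f g'"
    and sc1: "\<And>c f g. f \<in> V \<Longrightarrow> g \<in> W \<Longrightarrow> \<beta> (fscale c f) g = scale c (\<beta> f g)"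
    and sc2: "\<And>c f g. f \<in> V \<Longrightarrow> g \<in> W \<Longrightarrow> \<beta> f (fscale c g) = scale c (\<beta> f g)"
  obtains L where "Vector_Spaces.linear fscale scale L"
    and "\<And>f g. f \<in> V \<Longrightarrow> g \<in> W \<Longrightarrow> L (pure_tensor f g) = \<beta> f g"
proof -
  interpret X: vector_space scale by fact
  interpret vp: vector_space_pair "fscale :: 'k \<Rightarrow> ('v \<times> 'w \<Rightarrow> 'k) \<Rightarrow> _" scale ..
  let ?t = "\<lambda>(b, d). pure_tensor b d :: 'v \<times> 'w \<Rightarrow> 'k"
  obtain B where B: "B \<subseteq> V" "fs.independent B" "V \<subseteq> fs.span B"
    using fs.maximal_independent_subset by blast
  obtain D where D: "D \<subseteq> W" "fs.independent D" "W \<subseteq> fs.span D"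
    using fs.maximal_independent_subset by blast
  have BV: "fs.span B = V" and DW: "fs.span D = W"
    using B D V W by (auto dest: fs.span_subspace)
  note tb = pure_tensor_basis[OF B(2) D(2)]
  define L where
    "L = vp.construct (?t ` (B \<times> D)) (\<lambda>x. case inv_into (B \<times> D) ?t x of (b, d) \<Rightarrow> \<beta> b d)"
  have L: "Vector_Spaces.linear fscale scale L"
    unfolding L_def by (rule vp.linear_construct[OF tb(2)])
  interpret L: Vector_Spaces.linear fscale scale L by (rule L)
  have on_basis: "L (pure_tensor b d) = \<beta> b d" if "b \<in> B" "d \<in> D" for b d
  proof -
    have "pure_tensor b d \<in> ?t ` (B \<times> D)" using that by force
    moreover have "inv_into (B \<times> D) ?t (pure_tensor b d) = (b, d)"
      using inv_into_f_f[OF tb(1), of "(b, d)"] that by simp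
    ultimately show ?thesis
      unfolding L_def using vp.construct_basis[OF tb(2)] by simp
  qed
  have zero1: "\<beta> 0 g = 0" if "g \<in> W" for g
    using add1[of 0 0 g] fs.subspace_0[OF V] that by simp
  have zero2: "\<beta> f 0 = 0" if "f \<in> V" for f
    using add2[of f 0 0] fs.subspace_0[OF W] that by simp
  have pt0: "pure_tensor 0 g = 0" "pure_tensor f 0 = 0"
    for f :: "'v \<Rightarrow> 'k" and g :: "'w \<Rightarrow> 'k"
    by (auto simp: pure_tensor_def fun_eq_iff)
  have on_left: "L (pure_tensor b g) = \<beta> b g" if b: "b \<in> B" and g: "g \<in> fs.span D" for b g
  proof -
    have bV: "b \<in> V" using b B(1) by blast
    from g have "g \<in> W \<and> L (pure_tensor b g) = \<beta> b g"
    proof (induction rule: fs.span_induct_alt)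
      case base
      show ?case using bV fs.subspace_0[OF W] by (simp only: pt0 zero2 L.zero simp_thms)
    next
      case (step c x y)
      have *: "x \<in> W" "fscale c x \<in> W" "y \<in> W"
        using step D(1) fs.subspace_scale[OF W] by auto
      have "L (pure_tensor b (fscale c x + y)) = scale c (L (pure_tensor b x)) + L (pure_tensor b y)"
        by (simp only: pure_tensor_bilinear L.add L.scale)
      also have "\<dots> = scale c (\<beta> b x) + \<beta> b y"
        using step on_basis b by simp
      also have "\<dots> = \<beta> b (fscale c x + y)"
        by (simp only: add2 sc2 * bV)
      finally show ?case using fs.subspace_add[OF W *(2,3)] by blast
    qed
    then show ?thesis by blast
  qed
  have "L (pure_tensor f g) = \<beta> f g" if f: "f \<in> fs.span B" and g: "g \<in> W" for f g
  proof -
    from f have "f \<in> V \<and> L (pure_tensor f g) = \<beta> f g"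
    proof (induction rule: fs.span_induct_alt)
      case base
      show ?case using g fs.subspace_0[OF V] by (simp only: pt0 zero1 L.zero simp_thms)
    next
      case (step c x y)
      have *: "x \<in> V" "fscale c x \<in> V" "y \<in> V"
        using step B(1) fs.subspace_scale[OF V] by auto
      have "L (pure_tensor (fscale c x + y) g) = scale c (L (pure_tensor x g)) + L (pure_tensor y g)"
        by (simp only: pure_tensor_bilinear L.add L.scale)
      also have "\<dots> = scale c (\<beta> x g) + \<beta> y g"
        using step on_left g DW by simp
      also have "\<dots> = \<beta> (fscale c x + y) g"
        by (simp only: add1 sc1 * g)
      finally show ?case using fs.subspace_add[OF V *(2,3)] by blast
    qed
    then show ?thesis by blast
  qed
  with L BV show thesis by (intro that[of L]) auto
qed

lemma tensor_space_unique:
  assumes L: "Vector_Spaces.linear fscale scale L" and L': "Vector_Spaces.linear fscale scale L'"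
    and eq: "\<And>f g. f \<in> V \<Longrightarrow> g \<in> W \<Longrightarrow> L (pure_tensor f g) = L' (pure_tensor f g)"
    and x: "x \<in> tensor_space V W"
  shows "L x = L' x"
proof -
  interpret L: Vector_Spaces.linear fscale scale L by (rule L)
  interpret vp: vector_space_pair fscale scale ..
  show ?thesis
    by (rule vp.linear_eq_on[OF L L' x[unfolded tensor_space_def]]) (use eq in auto)
qed

end

theory Submission
  imports Defs "HOL-Combinatorics.Stirling" "HOL-Computational_Algebra.Formal_Power_Series"
begin

text \<open>
  The functions \<open>m_fun n A\<close> with at most \<open>n\<close> blocks and the functions \<open>bold_m n \<mu>\<close> with at most
  \<open>n\<close> parts have pairwise disjoint supports, so they are homogeneous bases. Since the numbers of
  set partitions with \<open>k\<close> blocks are the Stirling numbers of the second kind, the Hilbert series are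
  \<open>F\<^sub>n = \<Sum>k\<le>n. t^k / ((1 - t) \<dots> (1 - k t))\<close> for \<open>NCSym\<close> and \<open>1 / P\<^sub>n\<close> with
  \<open>P\<^sub>n = (1 - t) \<dots> (1 - t^n)\<close> for \<open>Lambda\<close>, and the theorem reduces to the nonnegativity of the
  coefficients of \<open>G\<^sub>n = P\<^sub>n F\<^sub>n\<close>: any choice of \<open>G\<^sub>n $ i\<close> basis elements of \<open>NCSym\<close> in each degree
  \<open>i\<close> spans a suitable \<open>C\<close>.

  With \<open>Q\<^sub>n = \<Prod>i=1..n. (1 - t^i) / (1 - i t)\<close> one has \<open>G\<^sub>n = G\<^sub>n\<^sub>-\<^sub>1 + t^n (Q\<^sub>n - G\<^sub>n\<^sub>-\<^sub>1)\<close>. If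
  \<open>0 \<le> G\<^sub>n\<^sub>-\<^sub>1 \<le> Q\<^sub>n\<close> coefficientwise, then \<open>0 \<le> G\<^sub>n \<le> (1 + t^n) Q\<^sub>n \<le> Q\<^sub>n\<^sub>+\<^sub>1\<close>, since
  \<open>(1 - t^(n+1)) / (1 - (n+1) t)\<close> dominates \<open>1 + t^n\<close>. The case \<open>n = \<infinity>\<close> follows because in
  degrees at most \<open>d\<close> it agrees with the case \<open>n = d\<close>.
\<close>

unbundle fps_syntax

interpretation fs_pair: vector_space_pair
  "fscale :: 'k::field \<Rightarrow> ('v \<Rightarrow> 'k) \<Rightarrow> _" "fscale :: 'k \<Rightarrow> ('w \<Rightarrow> 'k) \<Rightarrow> _" ..


section \<open>Graded bases\<close>

definition homogeneous :: "('w \<Rightarrow> nat) \<Rightarrow> nat \<Rightarrow> ('w \<Rightarrow> 'k::zero) set" where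
  "homogeneous deg d = {f. \<forall>w. f w \<noteq> 0 \<longrightarrow> deg w = d}"

lemma degree_part_eq_Int: "degree_part d V = V \<inter> homogeneous length d"
  by (auto simp: degree_part_def homogeneous_def)

lemma subspace_homogeneous: "fs.subspace (homogeneous deg d :: ('w \<Rightarrow> 'k::field) set)"
proof (rule fs.subspaceI)
  fix f g :: "'w \<Rightarrow> 'k"
  assume "f \<in> homogeneous deg d" "g \<in> homogeneous deg d"
  moreover have "f w \<noteq> 0 \<or> g w \<noteq> 0" if "(f + g) w \<noteq> 0" for w
    using that by auto
  ultimately show "f + g \<in> homogeneous deg d"
    unfolding homogeneous_def by blast
qed (auto simp: homogeneous_def fscale_def)

lemma disjoint_family_if_homogeneous:
  assumes hom: "\<And>d. B d \<subseteq> homogeneous deg d" and nz: "0 \<notin> (\<Union>d. B d)"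
  shows "disjoint_family B"
proof -
  have "d = e" if b: "b \<in> B d" "b \<in> B e" for b d e
  proof -
    have "b \<noteq> 0" using b nz by blast
    then obtain w where "b w \<noteq> 0" by (auto simp: fun_eq_iff)
    moreover have "b \<in> homogeneous deg d" "b \<in> homogeneous deg e" using hom b by blast+
    ultimately show ?thesis unfolding homogeneous_def by blast
  qed
  then show ?thesis by (auto simp: disjoint_family_on_def)
qed

lemma linear_homogeneous_component:
  "Vector_Spaces.linear fscale fscale (homogeneous_component d :: (nat list \<Rightarrow> 'k::field) \<Rightarrow> _)"
  by unfold_locales (auto simp: homogeneous_component_def fscale_def fun_eq_iff algebra_simps)

lemma homogeneous_component_of_homogeneous:
  "f \<in> homogeneous length i \<Longrightarrow> homogeneous_component d f = (if i = d then f else 0)"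
  by (auto simp: homogeneous_component_def homogeneous_def fun_eq_iff)

definition graded_basis ::
  "(nat \<Rightarrow> (nat list \<Rightarrow> 'k::field) set) \<Rightarrow> (nat list \<Rightarrow> 'k) set \<Rightarrow> bool" where
  "graded_basis B V \<longleftrightarrow>
     (\<forall>d. B d \<subseteq> homogeneous length d) \<and> fs.independent (\<Union>d. B d) \<and> fs.span (\<Union>d. B d) = V"

lemma
  assumes "graded_basis B V"
  shows graded_basis_homogeneous: "B d \<subseteq> homogeneous length d"
    and graded_basis_independent: "fs.independent (\<Union>d. B d)"
    and graded_basis_span: "fs.span (\<Union>d. B d) = V"
  using assms by (auto simp: graded_basis_def)

lemma disjoint_family_graded_basis:
  assumes "graded_basis B V"
  shows "disjoint_family B"
proof (rule disjoint_family_if_homogeneous)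
  show "0 \<notin> (\<Union>d. B d)"
    using graded_basis_independent[OF assms] fs.dependent_zero by blast
qed (rule graded_basis_homogeneous[OF assms])

lemma graded_basis_subfamily:
  assumes "graded_basis B V" "\<And>d. Y d \<subseteq> B d"
  shows "graded_basis Y (fs.span (\<Union>d. Y d))"
proof -
  have "(\<Union>d. Y d) \<subseteq> (\<Union>d. B d)" using assms(2) by (rule UN_mono[OF order_refl])
  then have "fs.independent (\<Union>d. Y d)"
    by (rule fs.independent_mono[OF graded_basis_independent[OF assms(1)]])
  moreover have "Y d \<subseteq> homogeneous length d" for d
    using assms(2) graded_basis_homogeneous[OF assms(1)] by (rule order_trans)
  ultimately show ?thesis by (simp add: graded_basis_def)
qed

lemma homogeneous_component_in_span:
  fixes f :: "nat list \<Rightarrow> 'k::field"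
  assumes B: "graded_basis B V" and f: "f \<in> V"
  shows "homogeneous_component d f \<in> fs.span (B d)"
proof -
  let ?h = "homogeneous_component d :: (nat list \<Rightarrow> 'k) \<Rightarrow> _"
  have "?h f \<in> ?h ` fs.span (\<Union>i. B i)"
    using f graded_basis_span[OF B] by blast
  also have "\<dots> = fs.span (?h ` (\<Union>i. B i))"
    by (rule fs_pair.linear_span_image[OF linear_homogeneous_component, symmetric])
  also have "\<dots> \<subseteq> fs.span (insert 0 (B d))"
  proof (rule fs.span_mono, clarify)
    fix b i assume "b \<in> B i" "?h b \<notin> B d"
    then show "?h b = 0"
      using homogeneous_component_of_homogeneous[of b i d] graded_basis_homogeneous[OF B, of i]
      by (auto split: if_splits)
  qed
  finally show ?thesis by simp
qed

lemma degree_part_eq_span: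
  assumes B: "graded_basis B V"
  shows "degree_part d V = fs.span (B d)"
proof
  show "degree_part d V \<subseteq> fs.span (B d)"
  proof
    fix f assume "f \<in> degree_part d V"
    then have "f \<in> V" "f \<in> homogeneous length d" by (simp_all add: degree_part_eq_Int)
    then show "f \<in> fs.span (B d)"
      using homogeneous_component_in_span[OF B, of f d]
      by (simp add: homogeneous_component_of_homogeneous)
  qed
  have "B d \<subseteq> V" using fs.span_superset graded_basis_span[OF B] by blast
  then have "fs.span (B d) \<subseteq> V"
    using fs.span_minimal fs.subspace_span graded_basis_span[OF B] by metis
  moreover have "fs.span (B d) \<subseteq> homogeneous length d"
    by (rule fs.span_minimal[OF graded_basis_homogeneous[OF B] subspace_homogeneous])
  ultimately show "fs.span (B d) \<subseteq> degree_part d V"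
    by (simp add: degree_part_eq_Int)
qed

lemma graded_subspace_if_graded_basis:
  assumes C: "graded_basis Y C" and "C \<subseteq> V"
  shows "graded_subspace C V"
  unfolding graded_subspace_def
proof (intro conjI ballI allI)
  show "fs.subspace C" using fs.subspace_span graded_basis_span[OF C] by metis
  fix f d assume "f \<in> C"
  with C have "homogeneous_component d f \<in> fs.span (Y d)"
    by (rule homogeneous_component_in_span)
  also have "\<dots> \<subseteq> C"
    using degree_part_eq_span[OF C, of d] by (auto simp: degree_part_def)
  finally show "homogeneous_component d f \<in> C" .
qed fact

lemma sum_fun_apply: "(\<Sum>x\<in>X. h x) y = (\<Sum>x\<in>X. h x y)"
  for h :: "'x \<Rightarrow> 'y \<Rightarrow> 'k::comm_monoid_add"
  by (induction X rule: infinite_finite_induct) auto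

lemma inj_on_if_disjoint_supports:
  assumes nz: "\<And>i. i \<in> I \<Longrightarrow> f i \<noteq> 0" and disj: "disjoint_family_on (\<lambda>i. {w. f i w \<noteq> 0}) I"
  shows "inj_on f I"
proof (rule inj_onI)
  fix i j assume ij: "i \<in> I" "j \<in> I" "f i = f j"
  obtain w where "f i w \<noteq> 0" using nz[OF ij(1)] by (auto simp: fun_eq_iff)
  with ij disj show "i = j" unfolding disjoint_family_on_def by fastforce
qed

lemma independent_if_disjoint_supports:
  fixes f :: "'i \<Rightarrow> 'w \<Rightarrow> 'k::field"
  assumes nz: "\<And>i. i \<in> I \<Longrightarrow> f i \<noteq> 0" and disj: "disjoint_family_on (\<lambda>i. {w. f i w \<noteq> 0}) I"
  shows "fs.independent (f ` I)"
  unfolding fs.independent_explicit_finite_subsets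
proof (intro allI impI ballI)
  fix S u b
  assume S: "S \<subseteq> f ` I" "finite S" and sum_0: "(\<Sum>v\<in>S. fscale (u v) v) = 0" and b: "b \<in> S"
  from S(1) b obtain i where i: "i \<in> I" "b = f i" by blast
  then obtain w where w: "b w \<noteq> 0" using nz[of i] by (auto simp: fun_eq_iff)
  have vanish: "v w = 0" if "v \<in> S - {b}" for v
    using that S(1) i w disj unfolding disjoint_family_on_def by fastforce
  have "0 = (\<Sum>v\<in>S. fscale (u v) v) w" by (simp add: sum_0)
  also have "\<dots> = (\<Sum>v\<in>S. u v * v w)" by (simp add: sum_fun_apply fscale_def)
  also have "\<dots> = (\<Sum>v\<in>{b}. u v * v w)"
    using S b vanish by (intro sum.mono_neutral_right) simp_all
  finally show "u b = 0" using w by simp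
qed

lemma graded_basis_if_disjoint_supports:
  fixes f :: "'i \<Rightarrow> nat list \<Rightarrow> 'k::field"
  assumes "\<And>d i. i \<in> I d \<Longrightarrow> f i \<in> homogeneous length d"
    and "\<And>d i. i \<in> I d \<Longrightarrow> f i \<noteq> 0"
    and "disjoint_family_on (\<lambda>i. {w. f i w \<noteq> 0}) (\<Union>d. I d)"
  shows "graded_basis (\<lambda>d. f ` I d) (fs.span (f ` (\<Union>d. I d)))"
  using assms independent_if_disjoint_supports[of "\<Union>d. I d" f]
  by (auto simp: graded_basis_def simp flip: image_UN)


section \<open>Graded tensor products\<close>

lemma linear_pure_tensor:
  "Vector_Spaces.linear fscale fscale (\<lambda>f. pure_tensor f g)"
  "Vector_Spaces.linear fscale fscale (pure_tensor f)"
  by unfold_locales (auto simp: pure_tensor_bilinear)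

lemma pure_tensor_in_span:
  assumes f: "f \<in> fs.span B" and g: "g \<in> fs.span D"
  shows "pure_tensor f g \<in> fs.span ((\<lambda>(b, d). pure_tensor b d) ` (B \<times> D))" (is "_ \<in> ?S")
proof -
  have "pure_tensor b g \<in> ?S" if "b \<in> B" for b
  proof -
    have "pure_tensor b g \<in> fs.span (pure_tensor b ` D)"
      using g by (simp add: fs_pair.linear_span_image[OF linear_pure_tensor(2)])
    also have "\<dots> \<subseteq> ?S" using that by (intro fs.span_mono) auto
    finally show ?thesis .
  qed
  then have "fs.span ((\<lambda>b. pure_tensor b g) ` B) \<subseteq> ?S"
    by (intro fs.span_minimal fs.subspace_span) blast
  moreover have "pure_tensor f g \<in> fs.span ((\<lambda>b. pure_tensor b g) ` B)"
    using f by (simp add: fs_pair.linear_span_image[OF linear_pure_tensor(1)])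
  ultimately show ?thesis by blast
qed

lemma tensor_space_span:
  "tensor_space (fs.span B) (fs.span D) = fs.span ((\<lambda>(b, d). pure_tensor b d) ` (B \<times> D))"
proof
  show "tensor_space (fs.span B) (fs.span D) \<subseteq> fs.span ((\<lambda>(b, d). pure_tensor b d) ` (B \<times> D))"
    unfolding tensor_space_def
    by (rule fs.span_minimal) (auto intro: pure_tensor_in_span fs.subspace_span)
  show "fs.span ((\<lambda>(b, d). pure_tensor b d) ` (B \<times> D)) \<subseteq> tensor_space (fs.span B) (fs.span D)"
    unfolding tensor_space_def by (rule fs.span_mono) (auto intro: fs.span_base)
qed

lemma pure_tensor_homogeneous:
  assumes "f \<in> homogeneous deg i" "g \<in> homogeneous deg' j"
  shows "pure_tensor f g \<in> homogeneous (\<lambda>(u, v). deg u + deg' v) (i + j)"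
  using assms by (auto simp: homogeneous_def pure_tensor_def)

definition graded_tensors ::
  "(nat \<Rightarrow> ('v \<Rightarrow> 'k::field) set) \<Rightarrow> (nat \<Rightarrow> ('w \<Rightarrow> 'k) set) \<Rightarrow> nat \<Rightarrow> ('v \<times> 'w \<Rightarrow> 'k) set" where
  "graded_tensors B D d = (\<lambda>(b, e). pure_tensor b e) ` (\<Union>i\<le>d. B i \<times> D (d - i))"

lemma UN_graded_tensors:
  "(\<Union>d. graded_tensors B D d) = (\<lambda>(b, e). pure_tensor b e) ` ((\<Union>i. B i) \<times> (\<Union>i. D i))"
proof -
  have "(\<Union>d. \<Union>i\<le>d. B i \<times> D (d - i)) = (\<Union>i. B i) \<times> (\<Union>i. D i)"
  proof
    show "(\<Union>i. B i) \<times> (\<Union>i. D i) \<subseteq> (\<Union>d. \<Union>i\<le>d. B i \<times> D (d - i))"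
    proof clarify
      fix b e i j assume "b \<in> B i" "e \<in> D j"
      then show "(b, e) \<in> (\<Union>d. \<Union>i\<le>d. B i \<times> D (d - i))"
        by (intro UN_I[of "i + j"] UN_I[of i]) auto
    qed
  qed auto
  then show ?thesis
    by (simp only: graded_tensors_def image_UN[symmetric])
qed

lemma tensor_space_eq_span:
  assumes "graded_basis B V" "graded_basis D W"
  shows "tensor_space V W = fs.span (\<Union>d. graded_tensors B D d)"
  using tensor_space_span[of "\<Union>d. B d" "\<Union>d. D d"]
  by (simp add: UN_graded_tensors graded_basis_span[OF assms(1)] graded_basis_span[OF assms(2)])

lemma independent_graded_tensors:
  assumes "graded_basis B V" "graded_basis D W"
  shows "fs.independent (\<Union>d. graded_tensors B D d)"
  unfolding UN_graded_tensors
  using assms[THEN graded_basis_independent] by (rule pure_tensor_basis(2))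

lemma disjoint_family_graded_tensors:
  assumes B: "graded_basis B V" and D: "graded_basis D W"
  shows "disjoint_family (graded_tensors B D)"
proof (rule disjoint_family_if_homogeneous)
  show "graded_tensors B D d \<subseteq> homogeneous (\<lambda>(u, v). length u + length v) d" for d
  proof (unfold graded_tensors_def, clarify)
    fix b e i assume "i \<le> d" "b \<in> B i" "e \<in> D (d - i)"
    moreover from calculation have "b \<in> homogeneous length i" "e \<in> homogeneous length (d - i)"
      using graded_basis_homogeneous[OF B] graded_basis_homogeneous[OF D] by blast+
    ultimately show "pure_tensor b e \<in> homogeneous (\<lambda>(u, v). length u + length v) d"
      using pure_tensor_homogeneous[of b length i e length "d - i"] by simp
  qed
  show "0 \<notin> (\<Union>d. graded_tensors B D d)"
    using independent_graded_tensors[OF B D] fs.dependent_zero by blast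
qed

lemma finite_graded_tensors:
  "(\<And>d. finite (B d)) \<Longrightarrow> (\<And>d. finite (D d)) \<Longrightarrow> finite (graded_tensors B D d)"
  by (simp add: graded_tensors_def)

lemma card_graded_tensors:
  assumes B: "graded_basis B V" and D: "graded_basis D W"
    and fin: "\<And>d. finite (B d)" "\<And>d. finite (D d)"
  shows "card (graded_tensors B D d) = (\<Sum>i\<le>d. card (B i) * card (D (d - i)))"
proof -
  have "inj_on (\<lambda>(b, e). pure_tensor b e) ((\<Union>i. B i) \<times> (\<Union>i. D i))"
    using B[THEN graded_basis_independent] D[THEN graded_basis_independent]
    by (rule pure_tensor_basis(1))
  then have "inj_on (\<lambda>(b, e). pure_tensor b e) (\<Union>i\<le>d. B i \<times> D (d - i))"
    by (rule inj_on_subset) blast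
  then have "card (graded_tensors B D d) = card (\<Union>i\<le>d. B i \<times> D (d - i))"
    unfolding graded_tensors_def by (rule card_image)
  also have "\<dots> = (\<Sum>i\<le>d. card (B i \<times> D (d - i)))"
    using disjoint_family_graded_basis[OF B] fin
    by (intro card_UN_disjoint) (auto simp: disjoint_family_on_def)
  finally show ?thesis by (simp add: card_cartesian_product)
qed

lemma tensor_degree_part_eq_span:
  assumes B: "graded_basis B V" and D: "graded_basis D W"
  shows "tensor_degree_part d V W = fs.span (graded_tensors B D d)"
proof
  note degree_part = degree_part_eq_span[OF B] degree_part_eq_span[OF D]
  show "tensor_degree_part d V W \<subseteq> fs.span (graded_tensors B D d)"
    unfolding tensor_degree_part_def
  proof (rule fs.span_minimal, clarify)
    fix f g i j
    assume "d = i + j" and "f \<in> degree_part i V" "g \<in> degree_part j W"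
    then have "pure_tensor f g \<in> fs.span ((\<lambda>(b, e). pure_tensor b e) ` (B i \<times> D j))"
      by (intro pure_tensor_in_span) (simp_all add: degree_part)
    also have "\<dots> \<subseteq> fs.span (graded_tensors B D (i + j))"
      unfolding graded_tensors_def by (intro fs.span_mono image_mono) fastforce
    finally show "pure_tensor f g \<in> fs.span (graded_tensors B D (i + j))" .
  qed (rule fs.subspace_span)
  show "fs.span (graded_tensors B D d) \<subseteq> tensor_degree_part d V W"
    unfolding tensor_degree_part_def graded_tensors_def
  proof (rule fs.span_mono, clarify)
    fix b e i assume "i \<le> d" "b \<in> B i" "e \<in> D (d - i)"
    then have "i + (d - i) = d" "b \<in> degree_part i V" "e \<in> degree_part (d - i) W"
      by (simp_all add: degree_part fs.span_base)
    then show "\<exists>f g i j. pure_tensor b e = pure_tensor f g \<and> i + j = d \<and>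
        f \<in> degree_part i V \<and> g \<in> degree_part j W"
      by blast
  qed
qed


section \<open>Graded isomorphisms\<close>

lemma bij_betw_glue_disjoint_families:
  assumes "disjoint_family A" "disjoint_family B" "\<And>i. \<exists>h. bij_betw h (A i) (B i)"
  obtains h where "\<And>i. bij_betw h (A i) (B i)" "bij_betw h (\<Union>i. A i) (\<Union>i. B i)"
proof -
  obtain g where g: "\<And>i. bij_betw (g i) (A i) (B i)" using assms(3) by metis
  define h where "h a = g (THE i. a \<in> A i) a" for a
  have "h a = g i a" if "a \<in> A i" for a i
  proof -
    have "(THE i. a \<in> A i) = i"
      using that assms(1) by (intro the_equality) (auto simp: disjoint_family_on_def)
    then show ?thesis by (simp add: h_def)
  qed
  then have "bij_betw h (A i) (B i)" for i
    using g[of i] by (simp cong: bij_betw_cong)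
  moreover from this have "bij_betw h (\<Union>i. A i) (\<Union>i. B i)"
    by (rule bij_betw_UNION_disjoint[OF assms(2)])
  ultimately show ?thesis by (rule that)
qed

lemma (in vector_space_pair) linear_iso_of_independent_families:
  assumes "vs1.independent (\<Union>i. A i)" "vs2.independent (\<Union>i. B i)"
    and "disjoint_family A" "disjoint_family B" "\<And>i. \<exists>h. bij_betw h (A i) (B i)"
  obtains \<phi> where "Vector_Spaces.linear s1 s2 \<phi>" "inj_on \<phi> (vs1.span (\<Union>i. A i))"
    and "\<phi> ` vs1.span (\<Union>i. A i) = vs2.span (\<Union>i. B i)"
    and "\<And>i. \<phi> ` vs1.span (A i) = vs2.span (B i)"
proof -
  obtain h where h: "\<And>i. bij_betw h (A i) (B i)" and h_UN: "bij_betw h (\<Union>i. A i) (\<Union>i. B i)"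
    by (rule bij_betw_glue_disjoint_families[OF assms(3-5)]) (rule that)
  define \<phi> where "\<phi> = construct (\<Union>i. A i) h"
  have lin: "Vector_Spaces.linear s1 s2 \<phi>"
    unfolding \<phi>_def by (rule linear_construct[OF assms(1)])
  have \<phi>: "\<phi> a = h a" if "a \<in> (\<Union>i. A i)" for a
    unfolding \<phi>_def by (rule construct_basis[OF assms(1) that])
  have "\<phi> ` A i = h ` A i" for i
    using \<phi> by (intro image_cong) auto
  then have image: "\<phi> ` A i = B i" for i
    using h[of i] by (simp add: bij_betw_def)
  then have image_union: "\<phi> ` (\<Union>i. A i) = (\<Union>i. B i)"
    by (simp add: image_UN)
  have "inj_on \<phi> (\<Union>i. A i)"
    using h_UN inj_on_cong[of "\<Union>i. A i" \<phi> h, OF \<phi>] by (simp add: bij_betw_def)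
  with assms(2) have "inj_on \<phi> (vs1.span (\<Union>i. A i))"
    by (intro linear_inj_on_span_independent_image[OF lin]) (simp_all add: image_union)
  moreover note linear_span_image[OF lin, symmetric]
  ultimately show ?thesis by (intro that[OF lin]) (simp_all only: image image_union)
qed

lemma graded_iso_tensor_space:
  fixes V C W :: "(nat list \<Rightarrow> 'k::field) set"
  assumes B: "graded_basis B V" and Y: "graded_basis Y C" and L: "graded_basis L W"
    and fin: "\<And>d. finite (B d)" "\<And>d. finite (Y d)" "\<And>d. finite (L d)"
    and card: "\<And>d. card (B d) = (\<Sum>i\<le>d. card (Y i) * card (L (d - i)))"
  obtains \<phi> :: "(nat list \<Rightarrow> 'k) \<Rightarrow> (nat list \<times> nat list \<Rightarrow> 'k)"
  where "linear_iso_betw \<phi> V (tensor_space C W)"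
    and "\<And>d. \<phi> ` degree_part d V = tensor_degree_part d C W"
proof -
  have "\<exists>h. bij_betw h (B d) (graded_tensors Y L d)" for d
    using fin by (intro finite_same_card_bij)
      (simp_all add: finite_graded_tensors card_graded_tensors[OF Y L] card)
  then obtain \<phi> where lin: "Vector_Spaces.linear fscale fscale \<phi>"
    and \<phi>: "inj_on \<phi> (fs.span (\<Union>d. B d))"
      "\<phi> ` fs.span (\<Union>d. B d) = fs.span (\<Union>d. graded_tensors Y L d)"
      "\<And>d. \<phi> ` fs.span (B d) = fs.span (graded_tensors Y L d)"
    by (rule fs_pair.linear_iso_of_independent_families[OF graded_basis_independent[OF B]
        independent_graded_tensors[OF Y L] disjoint_family_graded_basis[OF B]
        disjoint_family_graded_tensors[OF Y L]]) (rule that)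
  interpret \<phi>: Vector_Spaces.linear fscale fscale \<phi> by (rule lin)
  have "linear_iso_betw \<phi> V (tensor_space C W)"
    using \<phi>(1,2) graded_basis_span[OF B] tensor_space_eq_span[OF Y L]
    by (simp add: linear_iso_betw_def bij_betw_def \<phi>.add \<phi>.scale)
  moreover have "\<phi> ` degree_part d V = tensor_degree_part d C W" for d
    by (simp only: degree_part_eq_span[OF B] tensor_degree_part_eq_span[OF Y L] \<phi>(3))
  ultimately show ?thesis by (rule that)
qed

lemma ex_graded_tensor_complement:
  fixes V W :: "(nat list \<Rightarrow> 'k::field) set"
  assumes B: "graded_basis B V" and L: "graded_basis L W"
    and fin: "\<And>d. finite (B d)" "\<And>d. finite (L d)" and nonempty: "L 0 \<noteq> {}"
    and card: "\<And>d. card (B d) = (\<Sum>i\<le>d. c i * card (L (d - i)))"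
  shows "\<exists>C \<phi>. graded_subspace C V \<and> linear_iso_betw \<phi> V (tensor_space C W) \<and>
           (\<forall>d. \<phi> ` degree_part d V = tensor_degree_part d C W)"
proof -
  have "\<exists>Z\<subseteq>B d. card Z = c d" for d
  proof -
    have "c d \<le> c d * card (L (d - d))"
      using nonempty fin(2)[of 0] by (simp add: Suc_le_eq card_gt_0_iff)
    also have "\<dots> \<le> card (B d)"
      unfolding card by (rule member_le_sum) auto
    finally show ?thesis by (meson obtain_subset_with_card_n)
  qed
  then obtain Y where YB: "\<And>d. Y d \<subseteq> B d" and cardY: "\<And>d. card (Y d) = c d" by metis
  have Y: "graded_basis Y (fs.span (\<Union>d. Y d))"
    using B YB by (rule graded_basis_subfamily)
  have finY: "finite (Y d)" for d using YB fin(1) by (rule finite_subset)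
  have "fs.span (\<Union>d. Y d) \<subseteq> fs.span (\<Union>d. B d)"
    by (intro fs.span_mono UN_mono order_refl YB)
  then have "graded_subspace (fs.span (\<Union>d. Y d)) V"
    unfolding graded_basis_span[OF B] by (rule graded_subspace_if_graded_basis[OF Y])
  moreover obtain \<phi> where "linear_iso_betw \<phi> V (tensor_space (fs.span (\<Union>d. Y d)) W)"
    and "\<And>d. \<phi> ` degree_part d V = tensor_degree_part d (fs.span (\<Union>d. Y d)) W"
    by (rule graded_iso_tensor_space[OF B Y L fin(1) finY fin(2)]) (simp_all add: card cardY)
  ultimately show ?thesis by (intro exI conjI allI)
qed


section \<open>Counting set partitions\<close>

definition add_to_block :: "'a \<Rightarrow> 'a set set \<Rightarrow> 'a set \<Rightarrow> 'a set set" where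
  "add_to_block x P B = insert (insert x B) (P - {B})"

lemma partition_on_add_to_block:
  assumes P: "partition_on A P" and B: "B \<in> P" and x: "x \<notin> A"
  shows "partition_on (insert x A) (add_to_block x P B)"
proof -
  have "partition_on A (insert B (P - {B}))" using P B by (simp add: insert_absorb)
  moreover have "disjnt B (\<Union>(P - {B}))"
    using P B by (auto simp: partition_on_def disjoint_def disjnt_def)
  ultimately have "partition_on (A - B) (P - {B})" "B \<subseteq> A"
    using partition_on_insert by blast+
  moreover have "insert x A - insert x B = A - B" using x by blast
  moreover have "disjnt (insert x B) (\<Union>(P - {B}))"
    using \<open>disjnt B _\<close> P x by (auto simp: partition_on_def disjnt_def)
  ultimately show ?thesis
    by (auto simp: add_to_block_def partition_on_insert)
qed

lemma partition_on_insert_cases: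
  assumes Q: "partition_on (insert x A) Q" and x: "x \<notin> A"
  obtains (singleton) P where "partition_on A P" "Q = insert {x} P"
  | (add_to_block) P B where "partition_on A P" "B \<in> P" "Q = add_to_block x P B"
proof -
  obtain C where C: "C \<in> Q" "x \<in> C" using Q by (auto simp: partition_on_def)
  let ?R = "Q - {C}"
  have Q_eq: "insert C ?R = Q" using C by blast
  have disjoint: "disjnt C (\<Union>?R)"
    using Q C by (auto simp: partition_on_def disjoint_def disjnt_def)
  have "partition_on (insert x A) (insert C ?R)" unfolding Q_eq by (rule Q)
  then have R: "partition_on (insert x A - C) ?R" "C \<subseteq> insert x A"
    by (simp_all only: partition_on_insert[OF disjoint] simp_thms)
  show ?thesis
  proof (cases "C = {x}")
    case True
    with R(1) x have "partition_on A ?R" by simp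
    then show ?thesis by (rule singleton) (simp only: Q_eq flip: True)
  next
    case False
    let ?B = "C - {x}"
    have B: "?B \<noteq> {}" "?B \<subseteq> A" "A - ?B = insert x A - C" using C False R(2) x by auto
    have B_disjoint: "disjnt ?B (\<Union>?R)" using disjoint by (auto simp: disjnt_def)
    have "partition_on A (insert ?B ?R)"
      using R(1) B by (simp only: partition_on_insert[OF B_disjoint] simp_thms)
    moreover have "insert ?B ?R - {?B} = ?R" using B_disjoint B(1) by (auto simp: disjnt_def)
    then have "Q = add_to_block x (insert ?B ?R) ?B"
      using Q_eq C(2) by (simp only: add_to_block_def insert_Diff)
    ultimately show ?thesis by (rule add_to_block[OF _ insertI1])
  qed
qed

lemma singleton_notin_add_to_block:
  assumes "partition_on A P" "B \<in> P" "x \<notin> A"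
  shows "{x} \<notin> add_to_block x P B"
proof -
  have "B \<noteq> {}" "x \<notin> B" "{x} \<notin> P" using assms by (auto simp: partition_on_def)
  then show ?thesis by (auto simp: add_to_block_def)
qed

lemma card_add_to_block:
  assumes "partition_on A P" "B \<in> P" "x \<notin> A" "finite P"
  shows "card (add_to_block x P B) = card P"
proof -
  have "insert x B \<notin> P - {B}" using assms(1,3) by (auto simp: partition_on_def)
  with assms(4) have "card (add_to_block x P B) = Suc (card (P - {B}))"
    unfolding add_to_block_def by (intro card_insert_disjoint finite_Diff)
  also have "\<dots> = card P" by (rule card.remove[OF assms(4,2), symmetric])
  finally show ?thesis .
qed

lemma inj_on_add_to_block:
  assumes x: "x \<notin> A"
  shows "inj_on (\<lambda>(P, B). add_to_block x P B) (SIGMA P:{P. partition_on A P}. P)"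
proof (rule inj_onI, clarify)
  fix P B P' B'
  assume P: "partition_on A P" "B \<in> P" and P': "partition_on A P'" "B' \<in> P'"
    and eq: "add_to_block x P B = add_to_block x P' B'"
  have block: "C = insert x E"
    if "partition_on A R" "C \<in> add_to_block x R E" "x \<in> C" for R C E
    using that x by (auto simp: add_to_block_def partition_on_def)
  have "insert x B \<in> add_to_block x P' B'"
    unfolding eq[symmetric] by (simp add: add_to_block_def)
  then have "insert x B = insert x B'" using block[OF P'(1)] by blast
  moreover have "x \<notin> B" "x \<notin> B'"
    using P P' x by (auto simp: partition_on_def)
  ultimately have "B = B'" by (simp add: insert_ident)
  have rest: "R - {E} = add_to_block x R E - {insert x E}" if "partition_on A R" for R E
    using that x by (auto simp: add_to_block_def partition_on_def)
  have "P - {B} = P' - {B'}"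
    using rest[OF P(1), of B] rest[OF P'(1), of B'] eq \<open>B = B'\<close> by simp
  with P(2) P'(2) \<open>B = B'\<close> show "P = P' \<and> B = B'" by blast
qed

lemma partition_on_insert_singleton:
  assumes "partition_on A P" "x \<notin> A"
  shows "partition_on (insert x A) (insert {x} P)"
proof -
  have "disjnt {x} (\<Union>P)" using assms by (simp add: partition_on_def)
  then show ?thesis using assms by (simp add: partition_on_insert)
qed

definition partitions_into :: "'a set \<Rightarrow> nat \<Rightarrow> 'a set set set" where
  "partitions_into A k = {P. partition_on A P \<and> card P = k}"

lemma finite_partitions_into: "finite A \<Longrightarrow> finite (partitions_into A k)"
  unfolding partitions_into_def
  using finitely_many_partition_on[of A] by (rule rev_finite_subset) auto

lemma partitions_into_insert_Suc:
  assumes "finite A" "x \<notin> A"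
  shows "partitions_into (insert x A) (Suc k) =
    insert {x} ` partitions_into A k \<union>
    (\<lambda>(P, B). add_to_block x P B) ` (SIGMA P:partitions_into A (Suc k). P)"
    (is "?L = ?new \<union> ?add ` ?pairs")
proof -
  have fin: "finite P" and notin: "{x} \<notin> P" if "partition_on A P" for P
    using that assms finite_elements by (auto simp: partition_on_def)
  show ?thesis
  proof (intro equalityI subsetI)
    fix Q assume "Q \<in> ?L"
    then have Q: "partition_on (insert x A) Q" "card Q = Suc k"
      by (simp_all add: partitions_into_def)
    from Q(1) \<open>x \<notin> A\<close> show "Q \<in> ?new \<union> ?add ` ?pairs"
    proof (cases rule: partition_on_insert_cases)
      case (singleton P)
      with Q(2) fin notin have "P \<in> partitions_into A k" by (simp add: partitions_into_def)
      with singleton show ?thesis by blast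
    next
      case (add_to_block P B)
      with Q(2) fin \<open>x \<notin> A\<close> have "(P, B) \<in> ?pairs"
        by (simp add: partitions_into_def card_add_to_block)
      then have "?add (P, B) \<in> ?add ` ?pairs" by (rule imageI)
      with add_to_block(3) show ?thesis by simp
    qed
  next
    fix Q assume "Q \<in> ?new \<union> ?add ` ?pairs"
    then show "Q \<in> ?L"
      using fin notin \<open>x \<notin> A\<close>
      by (auto simp: partitions_into_def partition_on_insert_singleton partition_on_add_to_block
          card_add_to_block)
  qed
qed

lemma card_partitions_into_insert_Suc:
  assumes "finite A" "x \<notin> A"
  shows "card (partitions_into (insert x A) (Suc k)) =
    Suc k * card (partitions_into A (Suc k)) + card (partitions_into A k)"
proof -
  let ?new = "insert {x} ` partitions_into A k"
  let ?add = "\<lambda>(P, B). add_to_block x P B" and ?pairs = "SIGMA P:partitions_into A (Suc k). P"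
  have fin: "finite P" and notin: "{x} \<notin> P" if "P \<in> partitions_into A j" for P j
    using that assms finite_elements by (auto simp: partitions_into_def partition_on_def)
  have finite_pairs: "finite ?pairs"
    using finite_partitions_into[OF assms(1)] fin by blast
  have "?new \<inter> ?add ` ?pairs = {}"
    using singleton_notin_add_to_block[OF _ _ assms(2)] by (auto simp: partitions_into_def)
  then have "card (partitions_into (insert x A) (Suc k)) = card ?new + card (?add ` ?pairs)"
    unfolding partitions_into_insert_Suc[OF assms]
    using finite_partitions_into[OF assms(1)] finite_pairs by (intro card_Un_disjoint) auto
  moreover have "card ?new = card (partitions_into A k)"
    using notin by (intro card_image inj_onI) (simp add: insert_ident)
  moreover have "card (?add ` ?pairs) = Suc k * card (partitions_into A (Suc k))"
  proof -
    have "card (?add ` ?pairs) = card ?pairs"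
      by (rule card_image, rule inj_on_subset[OF inj_on_add_to_block[OF assms(2)]])
        (auto simp: partitions_into_def)
    also have "\<dots> = (\<Sum>P\<in>partitions_into A (Suc k). card P)"
      using finite_partitions_into[OF assms(1)] fin by (intro card_SigmaI) blast+
    finally show ?thesis by (simp add: partitions_into_def)
  qed
  ultimately show ?thesis by simp
qed

lemma card_partitions_into:
  assumes "finite A"
  shows "card (partitions_into A k) = Stirling (card A) k"
  using assms
proof (induction A arbitrary: k rule: finite_induct)
  case empty
  show ?case
    by (cases k) (auto simp: partitions_into_def partition_on_empty conj_commute cong: conj_cong)
next
  case (insert x A)
  show ?case
  proof (cases k)
    case 0
    have "P \<noteq> {}" "finite P" if "partition_on (insert x A) P" for P
      using that insert.hyps(1) finite_elements[of "insert x A" P] by (auto simp: partition_on_def)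
    then have "partitions_into (insert x A) 0 = {}"
      by (auto simp: partitions_into_def card_gt_0_iff)
    with 0 insert.hyps show ?thesis by simp
  next
    case (Suc j)
    with insert show ?thesis by (simp add: card_partitions_into_insert_Suc)
  qed
qed

definition bounded_set_partitions :: "enat \<Rightarrow> nat \<Rightarrow> nat set set set" where
  "bounded_set_partitions n d = {A. partition_on {1..d} A \<and> enat (card A) \<le> n}"

lemma finite_bounded_set_partitions: "finite (bounded_set_partitions n d)"
  unfolding bounded_set_partitions_def
  using finitely_many_partition_on[of "{1..d}"] by (rule rev_finite_subset) auto

lemma card_bounded_set_partitions:
  "card (bounded_set_partitions (enat m) d) = (\<Sum>k\<le>m. Stirling d k)"
proof -
  have "bounded_set_partitions (enat m) d = (\<Union>k\<le>m. partitions_into {1..d} k)"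
    by (auto simp: bounded_set_partitions_def partitions_into_def)
  also have "card \<dots> = (\<Sum>k\<le>m. card (partitions_into {1..d} k))"
    by (intro card_UN_disjoint) (auto simp: finite_partitions_into, auto simp: partitions_into_def)
  finally show ?thesis by (simp add: card_partitions_into)
qed


section \<open>Counting integer partitions\<close>

definition bounded_partitions :: "enat \<Rightarrow> nat \<Rightarrow> nat multiset set" where
  "bounded_partitions n d = {\<mu>. 0 \<notin># \<mu> \<and> enat (size \<mu>) \<le> n \<and> sum_mset \<mu> = d}"

lemma size_le_sum_mset:
  fixes \<mu> :: "nat multiset"
  shows "0 \<notin># \<mu> \<Longrightarrow> size \<mu> \<le> sum_mset \<mu>"
  by (induction \<mu>) auto

lemma size_shape: "size (shape A) = card A"
  by (simp add: shape_def)

lemma finite_block: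
  assumes "partition_on A P" "finite A" "B \<in> P"
  shows "finite B"
  using assms finite_subset[of B A] by (auto simp: partition_on_def)

lemma sum_mset_shape:
  assumes "partition_on {1..d} A"
  shows "sum_mset (shape A) = d"
  using product_partition[OF assms finite_block[OF assms]]
  by (simp add: shape_def sum_unfold_sum_mset)

lemma zero_notin_shape:
  assumes A: "partition_on {1..d} A"
  shows "0 \<notin># shape A"
proof -
  have "B \<noteq> {}" "finite B" if "B \<in> A" for B
    using that A finite_block[OF A] by (auto simp: partition_on_def)
  then show ?thesis
    using finite_elements[OF _ A] by (auto simp: shape_def)
qed

lemma finite_bounded_partitions: "finite (bounded_partitions n d)"
proof (rule finite_subset)
  have "x \<le> sum_mset \<mu>" if "x \<in># \<mu>" for x :: nat and \<mu>
    using sum_mset.remove[OF that] by simp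
  then show "bounded_partitions n d \<subseteq> (\<Union>k\<le>d. multisets_of_size {..d} k)"
    using size_le_sum_mset by (auto simp: bounded_partitions_def multisets_of_size_def)
qed auto

text \<open>Columns are those of the Young diagram; the one that is added or removed is the longest.\<close>

definition add_column :: "nat \<Rightarrow> nat multiset \<Rightarrow> nat multiset" where
  "add_column k \<mu> = image_mset Suc (\<mu> + replicate_mset (k - size \<mu>) 0)"

definition remove_column :: "nat multiset \<Rightarrow> nat multiset" where
  "remove_column \<mu> = {#x \<in># image_mset (\<lambda>x. x - 1) \<mu>. x \<noteq> 0#}"

lemma remove_add_column:
  assumes "0 \<notin># \<mu>"
  shows "remove_column (add_column k \<mu>) = \<mu>"
proof -
  have "{#x \<in># \<mu>. x \<noteq> 0#} = {#x \<in># \<mu>. True#}"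
    by (rule filter_mset_cong) (use assms in metis)+
  then show ?thesis
    by (simp add: remove_column_def add_column_def multiset.map_comp comp_def)
qed

lemma add_remove_column:
  assumes "0 \<notin># \<mu>"
  shows "add_column (size \<mu>) (remove_column \<mu>) = \<mu>"
proof -
  let ?\<nu> = "image_mset (\<lambda>x. x - 1) \<mu>"
  have zeros: "?\<nu> = remove_column \<mu> + replicate_mset (count ?\<nu> 0) 0"
    using multiset_partition[of ?\<nu> "\<lambda>x. x \<noteq> 0"]
    by (simp add: remove_column_def filter_eq_replicate_mset)
  then have "size \<mu> = size (remove_column \<mu>) + count ?\<nu> 0"
    by (metis size_image_mset size_union size_replicate_mset)
  then have "add_column (size \<mu>) (remove_column \<mu>) = image_mset Suc ?\<nu>"
    using zeros by (simp add: add_column_def)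
  also have "\<dots> = image_mset (\<lambda>x. x) \<mu>"
    unfolding multiset.map_comp
    by (rule image_mset_cong) (use assms in \<open>metis comp_apply Suc_diff_1 gr0I\<close>)
  finally show ?thesis by simp
qed

lemma size_add_column: "size \<mu> \<le> k \<Longrightarrow> size (add_column k \<mu>) = k"
  by (simp add: add_column_def)

lemma sum_mset_add_column:
  assumes "size \<mu> \<le> k"
  shows "sum_mset (add_column k \<mu>) = sum_mset \<mu> + k"
proof -
  have "sum_mset (image_mset Suc \<nu>) = sum_mset \<nu> + size \<nu>" for \<nu>
    by (induction \<nu>) auto
  with assms show ?thesis by (simp add: add_column_def sum_mset_replicate_mset)
qed

lemma bij_betw_add_column:
  "bij_betw (add_column k) (bounded_partitions (enat k) d)
     {\<mu>. 0 \<notin># \<mu> \<and> size \<mu> = k \<and> sum_mset \<mu> = d + k}"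
proof (rule bij_betw_byWitness[where f' = remove_column])
  show "remove_column ` {\<mu>. 0 \<notin># \<mu> \<and> size \<mu> = k \<and> sum_mset \<mu> = d + k}
      \<subseteq> bounded_partitions (enat k) d"
  proof clarify
    fix \<mu> :: "nat multiset" assume \<mu>: "0 \<notin># \<mu>" "sum_mset \<mu> = d + size \<mu>"
    have "size (remove_column \<mu>) \<le> size \<mu>"
      using size_filter_mset_lesseq[of _ "image_mset (\<lambda>x. x - 1) \<mu>"]
      by (simp add: remove_column_def)
    moreover from this have "sum_mset (remove_column \<mu>) = d"
      using sum_mset_add_column[of "remove_column \<mu>" "size \<mu>"] \<mu> by (simp add: add_remove_column)
    moreover have "0 \<notin># remove_column \<mu>" by (simp add: remove_column_def)
    ultimately show "remove_column \<mu> \<in> bounded_partitions (enat (size \<mu>)) d"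
      by (simp add: bounded_partitions_def)
  qed
  show "add_column k ` bounded_partitions (enat k) d
      \<subseteq> {\<mu>. 0 \<notin># \<mu> \<and> size \<mu> = k \<and> sum_mset \<mu> = d + k}"
    by (auto simp: bounded_partitions_def size_add_column sum_mset_add_column)
      (auto simp: add_column_def split: if_splits)
qed (auto simp: bounded_partitions_def remove_add_column add_remove_column)

lemma card_bounded_partitions_Suc:
  "card (bounded_partitions (enat (Suc k)) d) = card (bounded_partitions (enat k) d) +
     (if d < Suc k then 0 else card (bounded_partitions (enat (Suc k)) (d - Suc k)))"
proof -
  let ?full = "{\<mu>. 0 \<notin># \<mu> \<and> size \<mu> = Suc k \<and> sum_mset \<mu> = d}"
  have split: "bounded_partitions (enat (Suc k)) d = bounded_partitions (enat k) d \<union> ?full"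
    by (auto simp: bounded_partitions_def)
  have "finite ?full"
    using finite_bounded_partitions[of "enat (Suc k)" d] unfolding split by simp
  then have "card (bounded_partitions (enat (Suc k)) d) =
      card (bounded_partitions (enat k) d) + card ?full"
    unfolding split
    by (intro card_Un_disjoint finite_bounded_partitions) (auto simp: bounded_partitions_def)
  moreover have "card ?full =
      (if d < Suc k then 0 else card (bounded_partitions (enat (Suc k)) (d - Suc k)))"
  proof (cases "d < Suc k")
    case True
    then have "?full = {}" using size_le_sum_mset by fastforce
    with True show ?thesis by (simp only: card.empty if_True)
  next
    case False
    then show ?thesis
      using bij_betw_same_card[OF bij_betw_add_column[of "Suc k" "d - Suc k"]] by simp
  qed
  ultimately show ?thesis by simp
qed


section \<open>Hilbert series\<close>

lemma fps_mult_mono: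
  fixes a b c e :: "'a::ordered_semiring fps"
  assumes "\<And>d. a $ d \<le> b $ d" "\<And>d. c $ d \<le> e $ d" "\<And>d. 0 \<le> a $ d" "\<And>d. 0 \<le> c $ d"
  shows "(a * c) $ d \<le> (b * e) $ d"
  unfolding fps_mult_nth
  by (intro sum_mono mult_mono) (use assms order_trans in blast)+

definition geom_fps :: "'a::comm_ring_1 \<Rightarrow> 'a fps" where
  "geom_fps c = Abs_fps (\<lambda>i. c ^ i)"

lemma geom_fps_mult: "geom_fps c * (1 - fps_const c * fps_X) = 1"
proof (rule fps_ext)
  fix i
  have "geom_fps c * (1 - fps_const c * fps_X) = geom_fps c - fps_const c * (geom_fps c * fps_X)"
    by (simp add: algebra_simps)
  then show "(geom_fps c * (1 - fps_const c * fps_X)) $ i = 1 $ i"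
    by (cases i) (simp_all add: geom_fps_def)
qed

definition stirling_fps :: "nat \<Rightarrow> int fps" where
  "stirling_fps k = Abs_fps (\<lambda>d. int (Stirling d k))"

lemma stirling_fps_0: "stirling_fps 0 = 1"
proof (rule fps_ext)
  show "stirling_fps 0 $ d = 1 $ d" for d
    by (cases d) (simp_all add: stirling_fps_def)
qed

lemma stirling_fps_Suc: "stirling_fps (Suc k) = fps_X * geom_fps (int (Suc k)) * stirling_fps k"
proof -
  let ?S = "stirling_fps (Suc k)" and ?c = "fps_const (int (Suc k))"
  have recurrence: "?S * (1 - ?c * fps_X) = fps_X * stirling_fps k"
  proof (rule fps_ext)
    fix d
    have "?S * (1 - ?c * fps_X) = ?S - ?c * (?S * fps_X)"
      by (simp add: algebra_simps)
    then show "(?S * (1 - ?c * fps_X)) $ d = (fps_X * stirling_fps k) $ d"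
      by (cases d) (simp_all add: stirling_fps_def distrib_right)
  qed
  have "?S = ?S * (geom_fps (int (Suc k)) * (1 - ?c * fps_X))"
    by (simp only: geom_fps_mult mult_1_right)
  also have "\<dots> = ?S * (1 - ?c * fps_X) * geom_fps (int (Suc k))"
    by (simp only: mult_ac)
  also have "\<dots> = fps_X * geom_fps (int (Suc k)) * stirling_fps k"
    by (simp only: recurrence) (simp only: mult_ac)
  finally show ?thesis .
qed

lemma stirling_fps_eq: "stirling_fps k = fps_X ^ k * (\<Prod>i=1..k. geom_fps (int i))"
  by (induction k) (simp_all only: stirling_fps_0 stirling_fps_Suc, simp_all add: mult_ac)

definition partition_fps :: "nat \<Rightarrow> int fps" where
  "partition_fps m = Abs_fps (\<lambda>d. int (card (bounded_partitions (enat m) d)))"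

definition euler_fps :: "nat \<Rightarrow> int fps" where
  "euler_fps m = (\<Prod>i=1..m. 1 - fps_X ^ i)"

lemma partition_fps_0: "partition_fps 0 = 1"
proof -
  have "bounded_partitions (enat 0) d = (if d = 0 then {{#}} else {})" for d
    by (auto simp: bounded_partitions_def)
  then show ?thesis by (simp add: partition_fps_def fps_eq_iff)
qed

lemma partition_fps_Suc: "partition_fps (Suc m) * (1 - fps_X ^ Suc m) = partition_fps m"
proof (rule fps_ext)
  fix d
  have "partition_fps (Suc m) * (1 - fps_X ^ Suc m) =
      partition_fps (Suc m) - partition_fps (Suc m) * fps_X ^ Suc m"
    by (simp add: algebra_simps)
  then show "(partition_fps (Suc m) * (1 - fps_X ^ Suc m)) $ d = partition_fps m $ d"
    by (simp only: fps_sub_nth fps_X_power_mult_right_nth)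
      (simp add: partition_fps_def card_bounded_partitions_Suc[of m d])
qed

lemma euler_fps_mult_partition_fps: "euler_fps m * partition_fps m = 1"
proof (induction m)
  case 0
  show ?case by (simp add: euler_fps_def partition_fps_0)
next
  case (Suc m)
  have "euler_fps (Suc m) = euler_fps m * (1 - fps_X ^ Suc m)"
    by (simp add: euler_fps_def)
  with Suc.IH partition_fps_Suc[of m] show ?case
    by (simp only: mult.assoc mult.commute[of "1 - fps_X ^ Suc m"])
qed

definition ratio_fps :: "nat \<Rightarrow> int fps" where
  "ratio_fps k = geom_fps (int k) * (1 - fps_X ^ k)"

lemma ratio_fps_nth:
  "ratio_fps k $ i = (if i < k then int k ^ i else int k ^ i - int k ^ (i - k))"
proof -
  have "ratio_fps k = geom_fps (int k) - geom_fps (int k) * fps_X ^ k"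
    by (simp add: ratio_fps_def algebra_simps)
  then show ?thesis
    by (simp add: fps_X_power_mult_right_nth geom_fps_def)
qed

lemma ratio_fps_nonneg: "k > 0 \<Longrightarrow> 0 \<le> ratio_fps k $ i"
  by (auto simp: ratio_fps_nth intro!: power_increasing)

lemma ratio_fps_ge:
  assumes "n > 0"
  shows "(1 + fps_X ^ n) $ i \<le> ratio_fps (Suc n) $ i"
proof (cases "i = 0 \<or> i = n")
  case True
  then show ?thesis using assms by (auto simp: ratio_fps_nth)
next
  case False
  then show ?thesis using ratio_fps_nonneg[of "Suc n" i] by simp
qed

definition ratio_prod_fps :: "nat \<Rightarrow> int fps" where
  "ratio_prod_fps n = (\<Prod>i=1..n. ratio_fps i)"

lemma ratio_prod_fps_Suc: "ratio_prod_fps (Suc n) = ratio_prod_fps n * ratio_fps (Suc n)"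
  by (simp add: ratio_prod_fps_def)

lemma ratio_prod_fps_nonneg: "0 \<le> ratio_prod_fps n $ d"
proof (induction n arbitrary: d)
  case (Suc n)
  then show ?case
    unfolding ratio_prod_fps_Suc fps_mult_nth
    by (intro sum_nonneg mult_nonneg_nonneg ratio_fps_nonneg) simp_all
qed (simp add: ratio_prod_fps_def)

lemma ratio_prod_fps_Suc_ge:
  assumes "n > 0"
  shows "ratio_prod_fps n $ d + (if d < n then 0 else ratio_prod_fps n $ (d - n))
    \<le> ratio_prod_fps (Suc n) $ d"
proof -
  have "ratio_prod_fps n $ d + (if d < n then 0 else ratio_prod_fps n $ (d - n)) =
      (ratio_prod_fps n * (1 + fps_X ^ n)) $ d"
    by (simp only: distrib_left mult_1_right fps_add_nth fps_X_power_mult_right_nth)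
  also have "\<dots> \<le> (ratio_prod_fps n * ratio_fps (Suc n)) $ d"
    using assms by (intro fps_mult_mono ratio_prod_fps_nonneg ratio_fps_ge) simp_all
  finally show ?thesis by (simp only: ratio_prod_fps_Suc)
qed

definition quotient_fps :: "nat \<Rightarrow> int fps" where
  "quotient_fps n = euler_fps n * (\<Sum>k\<le>n. stirling_fps k)"

lemma quotient_fps_0: "quotient_fps 0 = 1"
  by (simp add: quotient_fps_def euler_fps_def stirling_fps_0)

lemma euler_fps_mult_stirling_fps: "euler_fps n * stirling_fps n = fps_X ^ n * ratio_prod_fps n"
  by (simp add: euler_fps_def stirling_fps_eq ratio_prod_fps_def ratio_fps_def prod.distrib mult_ac)

lemma quotient_fps_Suc:
  "quotient_fps (Suc n) =
     quotient_fps n + fps_X ^ Suc n * (ratio_prod_fps (Suc n) - quotient_fps n)"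
proof -
  have "quotient_fps (Suc n) =
      euler_fps (Suc n) * (\<Sum>k\<le>n. stirling_fps k) + fps_X ^ Suc n * ratio_prod_fps (Suc n)"
    by (simp only: quotient_fps_def sum.atMost_Suc distrib_left euler_fps_mult_stirling_fps)
  also have "euler_fps (Suc n) * (\<Sum>k\<le>n. stirling_fps k) = quotient_fps n * (1 - fps_X ^ Suc n)"
    by (simp add: quotient_fps_def euler_fps_def mult_ac)
  finally show ?thesis
    by (simp add: algebra_simps)
qed

lemma quotient_fps_Suc_nth:
  "quotient_fps (Suc n) $ d = quotient_fps n $ d +
     (if d < Suc n then 0
      else ratio_prod_fps (Suc n) $ (d - Suc n) - quotient_fps n $ (d - Suc n))"
  unfolding quotient_fps_Suc fps_add_nth fps_X_power_mult_nth fps_sub_nth by simp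

text \<open>
  The upper bound is what keeps the induction going: it makes the correction term of
  \<open>quotient_fps_Suc\<close> nonnegative.
\<close>
lemma quotient_fps_bounds:
  "0 \<le> quotient_fps n $ d \<and> quotient_fps n $ d \<le> ratio_prod_fps (Suc n) $ d"
proof (induction n arbitrary: d)
  case 0
  have "ratio_prod_fps (Suc 0) = 1"
    using geom_fps_mult[of "1 :: int"] by (simp add: ratio_prod_fps_def ratio_fps_def)
  then show ?case by (simp add: quotient_fps_0)
next
  case (Suc n)
  have "0 \<le> quotient_fps (Suc n) $ d"
    using Suc.IH[of d] Suc.IH[of "d - Suc n"] unfolding quotient_fps_Suc_nth by simp
  moreover have "quotient_fps (Suc n) $ d \<le> ratio_prod_fps (Suc n) $ d +
      (if d < Suc n then 0 else ratio_prod_fps (Suc n) $ (d - Suc n))"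
    using Suc.IH[of d] Suc.IH[of "d - Suc n"] unfolding quotient_fps_Suc_nth by simp
  moreover have "\<dots> \<le> ratio_prod_fps (Suc (Suc n)) $ d"
    by (rule ratio_prod_fps_Suc_ge) simp
  ultimately show ?case by linarith
qed

lemma quotient_fps_stable:
  assumes "i \<le> n"
  shows "quotient_fps n $ i = quotient_fps i $ i"
  using assms by (induction rule: dec_induct) (simp_all add: quotient_fps_Suc_nth)

lemma card_bounded_set_partitions_eq_convolution:
  "int (card (bounded_set_partitions (enat m) d)) =
     (\<Sum>i\<le>d. quotient_fps m $ i * int (card (bounded_partitions (enat m) (d - i))))"
proof -
  have "quotient_fps m * partition_fps m =
      (\<Sum>k\<le>m. stirling_fps k) * (euler_fps m * partition_fps m)"
    by (simp add: quotient_fps_def mult_ac)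
  also have "\<dots> = (\<Sum>k\<le>m. stirling_fps k)"
    by (simp only: euler_fps_mult_partition_fps mult_1_right)
  finally have "(\<Sum>k\<le>m. stirling_fps k) $ d = (quotient_fps m * partition_fps m) $ d" by simp
  then show ?thesis
    by (simp add: fps_sum_nth fps_mult_nth atLeast0AtMost stirling_fps_def partition_fps_def
        card_bounded_set_partitions)
qed

lemma bounded_partitions_infinity:
  assumes "d \<le> m"
  shows "bounded_partitions \<infinity> d = bounded_partitions (enat m) d"
  using assms size_le_sum_mset by (fastforce simp: bounded_partitions_def)

lemma bounded_set_partitions_infinity:
  assumes "d \<le> m"
  shows "bounded_set_partitions \<infinity> d = bounded_set_partitions (enat m) d"
proof -
  have "card A \<le> m" if "partition_on {1..d} A" for A
    using size_le_sum_mset[OF zero_notin_shape[OF that]] assms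
    by (simp add: size_shape sum_mset_shape[OF that])
  then show ?thesis by (auto simp: bounded_set_partitions_def)
qed

lemma ex_bounded_set_partitions_convolution:
  "\<exists>c. \<forall>d. card (bounded_set_partitions n d) =
     (\<Sum>i\<le>d. c i * card (bounded_partitions n (d - i)))"
proof -
  have convolution: "card (bounded_set_partitions (enat m) d) =
      (\<Sum>i\<le>d. nat (quotient_fps m $ i) * card (bounded_partitions (enat m) (d - i)))" for m d
  proof -
    have "int (card (bounded_set_partitions (enat m) d)) =
        int (\<Sum>i\<le>d. nat (quotient_fps m $ i) * card (bounded_partitions (enat m) (d - i)))"
      using quotient_fps_bounds by (simp add: card_bounded_set_partitions_eq_convolution)
    then show ?thesis by (simp only: of_nat_eq_iff)
  qed
  show ?thesis
  proof (cases n)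
    case (enat m)
    with convolution show ?thesis by (intro exI[of _ "\<lambda>i. nat (quotient_fps m $ i)"]) simp
  next
    case infinity
    have "card (bounded_set_partitions \<infinity> d) =
        (\<Sum>i\<le>d. nat (quotient_fps i $ i) * card (bounded_partitions \<infinity> (d - i)))" for d
    proof -
      have "card (bounded_set_partitions \<infinity> d) =
          (\<Sum>i\<le>d. nat (quotient_fps d $ i) * card (bounded_partitions \<infinity> (d - i)))"
        by (simp add: bounded_set_partitions_infinity[of d d] bounded_partitions_infinity[of _ d]
            convolution)
      also have "\<dots> = (\<Sum>i\<le>d. nat (quotient_fps i $ i) * card (bounded_partitions \<infinity> (d - i)))"
        by (intro sum.cong refl) (metis quotient_fps_stable atMost_iff)
      finally show ?thesis .
    qed
    with infinity show ?thesis by (intro exI[of _ "\<lambda>i. nat (quotient_fps i $ i)"]) simp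
  qed
qed


section \<open>Bases of the symmetric functions in noncommuting variables\<close>

definition letter_positions :: "nat list \<Rightarrow> nat \<Rightarrow> nat set" where
  "letter_positions w x = {i \<in> {1..length w}. w ! (i - 1) = x}"

lemma word_type_eq_image: "word_type w = letter_positions w ` set w"
  by (auto simp: word_type_def letter_positions_def)

lemma inj_on_letter_positions: "inj_on (letter_positions w) (set w)"
proof (rule inj_onI)
  fix x y assume "x \<in> set w" and eq: "letter_positions w x = letter_positions w y"
  then obtain j where "j < length w" "w ! j = x" by (auto simp: in_set_conv_nth)
  then have "Suc j \<in> letter_positions w y"
    unfolding eq[symmetric] by (simp add: letter_positions_def)
  with \<open>w ! j = x\<close> show "x = y" by (simp add: letter_positions_def)
qed

lemma card_word_type: "card (word_type w) = card (set w)"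
  unfolding word_type_eq_image by (rule card_image[OF inj_on_letter_positions])

lemma length_eq_if_partition_on_word_type:
  assumes "partition_on {1..d} (word_type w)"
  shows "length w = d"
  using sum_mset_shape[OF assms] sum_mset_shape[OF word_type_partition_on[of w]] by simp

lemma partition_on_block_function:
  assumes A: "partition_on X A"
  obtains block where "block ` X = A" "\<And>B. B \<in> A \<Longrightarrow> {i \<in> X. block i = B} = B"
proof -
  have union: "X = \<Union>A" using A by (rule partition_onD1)
  then have "\<forall>i\<in>X. \<exists>B. B \<in> A \<and> i \<in> B" by blast
  then obtain block where "\<forall>i\<in>X. block i \<in> A \<and> i \<in> block i"
    by (rule bchoice[THEN exE])
  then have block: "block i \<in> A \<and> i \<in> block i" if "i \<in> X" for i using that by blast
  have block_unique: "block i = B" if "i \<in> B" "B \<in> A" for i B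
    using that union block[of i] disjointD[OF partition_onD2[OF A], of "block i" B] by blast
  have "B \<in> block ` X" if "B \<in> A" for B
  proof -
    have "B \<noteq> {}" using that partition_onD3[OF A] by blast
    then show ?thesis using that union block_unique by blast
  qed
  with block have "block ` X = A" by blast
  moreover have "{i \<in> X. block i = B} = B" if "B \<in> A" for B
    using that union block block_unique by blast
  ultimately show ?thesis by (rule that)
qed

lemma ex_word_of_type:
  assumes A: "partition_on {1..d} A"
  shows "\<exists>w. word_type w = A \<and> set w = {..<card A}"
proof -
  have "finite A" using finite_elements[OF _ A] by simp
  then obtain f where f: "bij_betw f A {..<card A}"
    using ex_bij_betw_finite_nat lessThan_atLeast0 by metis
  obtain block where block: "block ` {1..d} = A"
    and fiber: "\<And>B. B \<in> A \<Longrightarrow> {i \<in> {1..d}. block i = B} = B"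
    using partition_on_block_function[OF A] by metis
  define w where "w = map (f \<circ> block) [1..<Suc d]"
  have positions: "letter_positions w (f B) = B" if B: "B \<in> A" for B
  proof -
    have "letter_positions w (f B) = {i \<in> {1..d}. f (block i) = f B}"
      by (auto simp: w_def letter_positions_def simp del: upt_Suc)
    also have "\<dots> = {i \<in> {1..d}. block i = B}"
      using f block B by (auto simp: bij_betw_def dest: inj_onD)
    finally show ?thesis using fiber[OF B] by simp
  qed
  have "set w = f ` block ` {1..d}"
    by (auto simp: w_def atLeastLessThanSuc_atLeastAtMost simp del: upt_Suc)
  then have set: "set w = f ` A" by (simp only: block)
  then have "word_type w = A"
    unfolding word_type_eq_image by (simp add: image_image positions)
  with set f show ?thesis by (auto simp: bij_betw_def)
qed

lemma ex_monomial_of_type_iff: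
  assumes A: "partition_on {1..d} A"
  shows "(\<exists>w\<in>monomials n. word_type w = A) \<longleftrightarrow> enat (card A) \<le> n"
proof
  assume "\<exists>w\<in>monomials n. word_type w = A"
  then obtain w where w: "w \<in> monomials n" "word_type w = A" by blast
  show "enat (card A) \<le> n"
  proof (cases n)
    case (enat m)
    then have "set w \<subseteq> {..<m}" using w(1) by (auto simp: monomials_def)
    then have "card (set w) \<le> m" using card_mono[of "{..<m}" "set w"] by simp
    then show ?thesis using w(2) card_word_type[of w] enat by simp
  qed simp
next
  assume n: "enat (card A) \<le> n"
  obtain w where "word_type w = A" "set w = {..<card A}" using ex_word_of_type[OF A] by blast
  moreover have "enat x < n" if "x < card A" for x
    using that n by (meson enat_ord_simps(2) less_le_trans)
  ultimately show "\<exists>w\<in>monomials n. word_type w = A" by (auto simp: monomials_def)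
qed

lemma m_fun_nonzero_iff:
  assumes "partition_on {1..d} A"
  shows "(m_fun n A :: nat list \<Rightarrow> 'k::field) \<noteq> 0 \<longleftrightarrow> enat (card A) \<le> n"
  unfolding ex_monomial_of_type_iff[OF assms, symmetric] by (auto simp: m_fun_def fun_eq_iff)

lemma m_fun_homogeneous:
  "partition_on {1..d} A \<Longrightarrow> m_fun n A \<in> homogeneous length d"
  using length_eq_if_partition_on_word_type by (auto simp: homogeneous_def m_fun_def)

lemma disjoint_supports_m_fun:
  "disjoint_family_on (\<lambda>A. {w. (m_fun n A :: nat list \<Rightarrow> 'k::field) w \<noteq> 0}) I"
  by (auto simp: disjoint_family_on_def m_fun_def)

lemma graded_basis_NCSym:
  "graded_basis (\<lambda>d. m_fun n ` bounded_set_partitions n d) (NCSym n :: (nat list \<Rightarrow> 'k::field) set)"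
proof -
  let ?m = "m_fun n :: _ \<Rightarrow> nat list \<Rightarrow> 'k"
  have "NCSym n = fs.span ({?m A | A d. partition_on {1..d} A} - {0})"
    unfolding NCSym_def by (rule fs.span_delete_0[symmetric])
  also have "{?m A | A d. partition_on {1..d} A} - {0} = ?m ` (\<Union>d. bounded_set_partitions n d)"
    using m_fun_nonzero_iff[where 'k = 'k] by (fastforce simp: bounded_set_partitions_def)
  finally have NCSym_eq: "NCSym n = fs.span (?m ` (\<Union>d. bounded_set_partitions n d))" .
  show ?thesis
    unfolding NCSym_eq
    using m_fun_nonzero_iff m_fun_homogeneous
    by (intro graded_basis_if_disjoint_supports disjoint_supports_m_fun)
      (auto simp: bounded_set_partitions_def)
qed

lemma card_m_fun_image:
  "card (m_fun n ` bounded_set_partitions n d :: (nat list \<Rightarrow> 'k::field) set) =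
     card (bounded_set_partitions n d)"
  using m_fun_nonzero_iff disjoint_supports_m_fun
  by (intro card_image inj_on_if_disjoint_supports) (auto simp: bounded_set_partitions_def)


section \<open>Bases of the place-action invariants\<close>

lemma ex_set_partition_of_shape:
  assumes "0 \<notin># \<mu>"
  shows "\<exists>A. partition_on {1..sum_mset \<mu>} A \<and> shape A = \<mu>"
  using assms
proof (induction \<mu>)
  case empty
  show ?case by (intro exI[of _ "{}"]) (simp add: partition_on_empty shape_def)
next
  case (add x \<mu>)
  then obtain A where A: "partition_on {1..sum_mset \<mu>} A" "shape A = \<mu>" by auto
  define B where "B = {sum_mset \<mu> + 1..sum_mset \<mu> + x}"
  have B: "card B = x" "B \<noteq> {}" "{1..sum_mset \<mu> + x} - B = {1..sum_mset \<mu>}"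
      "B \<subseteq> {1..sum_mset \<mu> + x}"
    using add.prems by (auto simp: B_def)
  have B_disjoint: "disjnt B (\<Union>A)" using A(1) by (auto simp: B_def partition_on_def disjnt_def)
  then have "B \<notin> A" using B(2) by (auto simp: disjnt_def)
  then have "shape (insert B A) = add_mset x \<mu>"
    using A B(1) finite_elements[OF _ A(1)] by (simp add: shape_def)
  moreover have "partition_on {1..sum_mset \<mu> + x} (insert B A)"
    using A(1) B by (simp add: partition_on_insert[OF B_disjoint])
  ultimately show ?case by (intro exI[of _ "insert B A"]) (simp add: add.commute)
qed

lemma word_type_in_set_partitions_of_shape_iff:
  "word_type w \<in> set_partitions_of_shape \<mu> \<longleftrightarrow> shape (word_type w) = \<mu>"
  using word_type_partition_on[of w] sum_mset_shape[OF word_type_partition_on[of w]]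
  by (auto simp: set_partitions_of_shape_def)

lemma dim_NCSym_shape:
  assumes "enat (size \<mu>) \<le> n"
  shows "fs.dim (NCSym_shape n \<mu> :: (nat list \<Rightarrow> 'k::field) set) = card (set_partitions_of_shape \<mu>)"
proof -
  let ?m = "m_fun n :: _ \<Rightarrow> nat list \<Rightarrow> 'k"
  have nz: "?m A \<noteq> 0" if "A \<in> set_partitions_of_shape \<mu>" for A
  proof -
    have "partition_on {1..sum_mset \<mu>} A" "card A = size \<mu>"
      using that size_shape[of A] by (auto simp: set_partitions_of_shape_def)
    with assms show ?thesis by (simp add: m_fun_nonzero_iff)
  qed
  have "fs.dim (NCSym_shape n \<mu> :: (nat list \<Rightarrow> 'k) set) = card (?m ` set_partitions_of_shape \<mu>)"
    unfolding NCSym_shape_def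
    by (intro fs.dim_span_eq_card_independent independent_if_disjoint_supports
        disjoint_supports_m_fun nz)
  also have "\<dots> = card (set_partitions_of_shape \<mu>)"
    by (intro card_image inj_on_if_disjoint_supports disjoint_supports_m_fun nz)
  finally show ?thesis .
qed

lemma bold_m_apply_nonzero_iff:
  "(bold_m n \<mu> :: nat list \<Rightarrow> 'k::field_char_0) w \<noteq> 0 \<longleftrightarrow>
     w \<in> monomials n \<and> shape (word_type w) = \<mu>"
proof -
  let ?dim = "fs.dim (NCSym_shape n \<mu> :: (nat list \<Rightarrow> 'k) set)"
  have "(\<Sum>A\<in>set_partitions_of_shape \<mu>. m_fun n A) w =
      (\<Sum>A\<in>set_partitions_of_shape \<mu>. if A = word_type w then of_bool (w \<in> monomials n) else 0 :: 'k)"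
    unfolding sum_fun_apply by (intro sum.cong) (auto simp: m_fun_def)
  also have "\<dots> = of_bool (w \<in> monomials n \<and> shape (word_type w) = \<mu>)"
    by (simp add: finite_set_partitions_of_shape word_type_in_set_partitions_of_shape_iff)
  finally have "bold_m n \<mu> w = (1 / (of_nat ?dim * of_nat (mult_fact \<mu>)) :: 'k) *
      of_bool (w \<in> monomials n \<and> shape (word_type w) = \<mu>)"
    by (simp add: bold_m_def fscale_def)
  moreover have "?dim \<noteq> 0" if "w \<in> monomials n" "shape (word_type w) = \<mu>"
  proof -
    have "enat (size \<mu>) \<le> n"
      using that ex_monomial_of_type_iff[OF word_type_partition_on[of w]] size_shape[of "word_type w"]
      by auto
    moreover have "word_type w \<in> set_partitions_of_shape \<mu>"
      using that(2) by (simp add: word_type_in_set_partitions_of_shape_iff)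
    ultimately show ?thesis
      using finite_set_partitions_of_shape[of \<mu>] by (auto simp: dim_NCSym_shape)
  qed
  moreover have "mult_fact \<mu> \<noteq> 0" by (simp add: mult_fact_def)
  ultimately show ?thesis by auto
qed

lemma bold_m_nonzero_iff:
  assumes "0 \<notin># \<mu>"
  shows "(bold_m n \<mu> :: nat list \<Rightarrow> 'k::field_char_0) \<noteq> 0 \<longleftrightarrow> enat (size \<mu>) \<le> n"
proof
  assume "(bold_m n \<mu> :: nat list \<Rightarrow> 'k) \<noteq> 0"
  then obtain w where "(bold_m n \<mu> :: nat list \<Rightarrow> 'k) w \<noteq> 0" by (auto simp: fun_eq_iff)
  then have "w \<in> monomials n" "size \<mu> = card (word_type w)"
    using size_shape[of "word_type w"] by (auto simp: bold_m_apply_nonzero_iff)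
  then show "enat (size \<mu>) \<le> n"
    using ex_monomial_of_type_iff[OF word_type_partition_on[of w]] by auto
next
  assume n: "enat (size \<mu>) \<le> n"
  obtain A where A: "partition_on {1..sum_mset \<mu>} A" "shape A = \<mu>"
    using ex_set_partition_of_shape[OF assms] by blast
  then obtain w where "w \<in> monomials n" "word_type w = A"
    using ex_monomial_of_type_iff[OF A(1)] size_shape[of A] n by auto
  then have "(bold_m n \<mu> :: nat list \<Rightarrow> 'k) w \<noteq> 0"
    using A(2) by (simp add: bold_m_apply_nonzero_iff)
  then show "(bold_m n \<mu> :: nat list \<Rightarrow> 'k) \<noteq> 0" by auto
qed

lemma bold_m_homogeneous:
  "(bold_m n \<mu> :: nat list \<Rightarrow> 'k::field_char_0) \<in> homogeneous length (sum_mset \<mu>)"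
  using sum_mset_shape[OF word_type_partition_on]
  by (auto simp: homogeneous_def bold_m_apply_nonzero_iff)

lemma disjoint_supports_bold_m:
  "disjoint_family_on (\<lambda>\<mu>. {w. (bold_m n \<mu> :: nat list \<Rightarrow> 'k::field_char_0) w \<noteq> 0}) I"
  by (auto simp: disjoint_family_on_def bold_m_apply_nonzero_iff)

lemma graded_basis_Lambda:
  "graded_basis (\<lambda>d. bold_m n ` bounded_partitions n d)
     (Lambda n :: (nat list \<Rightarrow> 'k::field_char_0) set)"
proof -
  let ?m = "bold_m n :: _ \<Rightarrow> nat list \<Rightarrow> 'k"
  have "Lambda n = fs.span ({?m \<mu> | \<mu>. 0 \<notin># \<mu>} - {0})"
    unfolding Lambda_def by (rule fs.span_delete_0[symmetric])
  also have "{?m \<mu> | \<mu>. 0 \<notin># \<mu>} - {0} = ?m ` (\<Union>d. bounded_partitions n d)"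
    using bold_m_nonzero_iff[where 'k = 'k] by (fastforce simp: bounded_partitions_def)
  finally have Lambda_eq: "Lambda n = fs.span (?m ` (\<Union>d. bounded_partitions n d))" .
  show ?thesis
    unfolding Lambda_eq
    using bold_m_nonzero_iff bold_m_homogeneous
    by (intro graded_basis_if_disjoint_supports disjoint_supports_bold_m)
      (auto simp: bounded_partitions_def)
qed

lemma card_bold_m_image:
  "card (bold_m n ` bounded_partitions n d :: (nat list \<Rightarrow> 'k::field_char_0) set) =
     card (bounded_partitions n d)"
  using bold_m_nonzero_iff disjoint_supports_bold_m
  by (intro card_image inj_on_if_disjoint_supports) (auto simp: bounded_partitions_def)

theorem theorem1p1:
  fixes n :: enat
  assumes "n \<ge> 1"
  shows "\<exists>(C :: (nat list \<Rightarrow> 'k::field_char_0) set)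
            (\<phi> :: (nat list \<Rightarrow> 'k) \<Rightarrow> (nat list \<times> nat list \<Rightarrow> 'k)).
           graded_subspace C (NCSym n) \<and>
           linear_iso_betw \<phi> (NCSym n) (tensor_space C (Lambda n)) \<and>
           (\<forall>d. \<phi> ` degree_part d (NCSym n) = tensor_degree_part d C (Lambda n))"
proof -
  obtain c where c: "\<And>d. card (bounded_set_partitions n d) =
      (\<Sum>i\<le>d. c i * card (bounded_partitions n (d - i)))"
    using ex_bounded_set_partitions_convolution[of n] by blast
  show ?thesis
  proof (rule ex_graded_tensor_complement[OF graded_basis_NCSym graded_basis_Lambda])
    show "finite (m_fun n ` bounded_set_partitions n d :: (nat list \<Rightarrow> 'k) set)"
      "finite (bold_m n ` bounded_partitions n d :: (nat list \<Rightarrow> 'k) set)" for d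
      by (intro finite_imageI finite_bounded_set_partitions finite_bounded_partitions)+
    have "{#} \<in> bounded_partitions n 0"
      by (simp add: bounded_partitions_def zero_enat_def[symmetric])
    then show "bold_m n ` bounded_partitions n 0 \<noteq> ({} :: (nat list \<Rightarrow> 'k) set)" by blast
    show "card (m_fun n ` bounded_set_partitions n d :: (nat list \<Rightarrow> 'k) set) =
        (\<Sum>i\<le>d. c i * card (bold_m n ` bounded_partitions n (d - i) :: (nat list \<Rightarrow> 'k) set))" for d
      by (simp only: card_m_fun_image card_bold_m_image c)
  qed
qed

end
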